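(* (i) The algebra $S^{G_2}$ is generated by $S_1$, $T_1'=T_1^2$, $S_2$, $T_2'=T_2^2$, $Z=T_1T_2$, $H$, $U_{11}=T_1U_1$, $U_{12}=T_1U_2$, $U_{21}=T_2U_1$ and $U_{22}=T_2U_2$. (ii) Put $R'=\mathbb{C}[S_1,T_1',S_2,T_2']$. Every element $Q$ of $S^{G_2}$ can be written uniquely as $$Q=P_0+P_1H+P_2H^2+P_3H^3+Q_0Z+Q_1ZH+Q_2ZH^2+Q_3ZH^3+Q_{11}U_{11}+Q_{21}U_{21}+Q_{12}U_{12}+Q_{22}U_{22},$$ where the $P_i$, $Q_j$ and $Q_{kl}$ are elements of $R'$. (iii) $S^{G_2}$ is presented, as a commutative $\mathbb{C}$-algebra, by the generators $S_1,T_1',S_2,T_2',Z,H,U_{11},U_{12},U_{21},U_{22}$ and the relations $$\begin{aligned} Z^2&=T_1'T_2',\\ H^4&=-4S_1^2S_2^2-3ZH+5S_1S_2H^2-S_2U_{11}-S_1U_{22},\\ HU_{11}&=-3S_1Z-S_2U_{12},\\ HU_{12}&=-3S_2T_1'-S_1U_{11},\\ HU_{21}&=-3S_1T_2'-S_2U_{22},\\ HU_{22}&=-3S_2Z-S_1U_{21},\\ U_{11}^2&=12S_1S_2^2T_1'-3S_2T_1'H^2+3T_1'U_{22},\\ U_{11}U_{12}&=9ZT_1'-12S_1S_2T_1'H+3T_1'H^3,\\ U_{11}U_{21}&=12S_1S_2^2Z-3S_2ZH^2+3ZU_{22},\\ U_{11}U_{22}&=9Z^2-12S_1S_2ZH+3ZH^3,\\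 U_{12}^2&=12S_1^2S_2T_1'-3S_1T_1'H^2+3T_1'U_{11},\\ U_{12}U_{21}&=9Z^2-12S_1S_2ZH+3ZH^3,\\ U_{12}U_{22}&=12S_1^2S_2Z-3S_1ZH^2+3ZU_{11},\\ U_{21}^2&=12S_1S_2^2T_2'-3S_2T_2'H^2+3T_2'U_{22},\\ U_{21}U_{22}&=9ZT_2'-12S_1S_2T_2'H+3T_2'H^3,\\ U_{22}^2&=12S_1^2S_2T_2'-3S_1T_2'H^2+3T_2'U_{11},\\ ZU_{11}&=T_1'U_{21},\quad ZU_{12}=T_1'U_{22},\quad ZU_{21}=T_2'U_{11},\quad ZU_{22}=T_2'U_{12}. \end{aligned}$$
   Context: Let $S=\mathbb{C}[a_1,a_2,b_1,b_2]$ be a polynomial algebra in four variables and put $a_3=-a_1-a_2$, $b_3=-b_1-b_2$. The group $A_2=S_3$ acts on $S$ by algebra automorphisms by simultaneously permuting the indices of $a_1,a_2,a_3$ and of $b_1,b_2,b_3$. The group $G_2=A_2\times\{\pm \mathrm{Id}\}$ acts on $S$, where $-\mathrm{Id}$ sends each $a_i$ to $-a_i$ and each $b_i$ to $-b_i$; $S^{G_2}$ is the algebra of invariants. Define $S_1=-\frac{a_1a_2+a_2a_3+a_1a_3}{9}$, $T_1=-\frac{a_1a_2a_3}{9}$, $U_1=-\frac{a_1b_1^2+a_2b_2^2+a_3b_3^2}{9}$, $S_2=-\frac{b_1b_2+b_2b_3+b_1b_3}{9}$, $T_2=-\frac{b_1b_2b_3}{9}$, $U_2=-\frac{a_1^2b_1+a_2^2b_2+a_3^2b_3}{9}$,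 $H=-\frac{a_1b_1+a_2b_2+a_3b_3}{9}$. *)

theory Defs
  imports "HOL-Library.Poly_Mapping" "HOL-Algebra.Sym_Groups" Complex_Main
begin

section \<open>Polynomial algebras over the complex numbers\<close>

text \<open>
  A monomial is its exponent vector and a polynomial maps monomials to coefficients, with finite
  support. The multiplication of \<^typ>\<open>'m \<Rightarrow>\<^sub>0 complex\<close> from the library is convolution, so this type
  is the commutative polynomial algebra with variables of type \<^typ>\<open>'v\<close>.
\<close>

type_synonym 'v cpoly = "('v \<Rightarrow>\<^sub>0 nat) \<Rightarrow>\<^sub>0 complex"

definition Var :: "'v \<Rightarrow> 'v cpoly"
  where "Var v = Poly_Mapping.single (Poly_Mapping.single v 1) 1"

definition Const :: "complex \<Rightarrow> 'v cpoly"
  where "Const c = Poly_Mapping.single 0 c"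

text \<open>The algebra homomorphism sending each variable \<open>v\<close> to \<open>f v\<close>.\<close>

definition subst :: "('v \<Rightarrow> 'w cpoly) \<Rightarrow> 'v cpoly \<Rightarrow> 'w cpoly"
  where "subst f p =
    (\<Sum>m\<in>Poly_Mapping.keys p. Const (Poly_Mapping.lookup p m) *
      (\<Prod>v\<in>Poly_Mapping.keys m. f v ^ Poly_Mapping.lookup m v))"

inductive_set generated_algebra :: "'v cpoly set \<Rightarrow> 'v cpoly set" for X
  where
    const: "Const c \<in> generated_algebra X"
  | gen: "x \<in> X \<Longrightarrow> x \<in> generated_algebra X"
  | add: "p \<in> generated_algebra X \<Longrightarrow> q \<in> generated_algebra X \<Longrightarrow> p + q \<in> generated_algebra X"
  | mult: "p \<in> generated_algebra X \<Longrightarrow> q \<in> generated_algebra X \<Longrightarrow> p * q \<in> generated_algebra X"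

text \<open>
  Ideals are submodules of the ring over itself. The subalgebra \<open>A\<close> is presented by the
  generators \<open>g v\<close> and the relators \<open>Rel\<close> if the homomorphism from the free commutative algebra
  sending the variable \<open>v\<close> to \<open>g v\<close> has image \<open>A\<close> and its kernel is the ideal generated by \<open>Rel\<close>.
\<close>

definition generated_ideal :: "'v cpoly set \<Rightarrow> 'v cpoly set"
  where "generated_ideal = module.span (*)"

definition presented_by :: "'w cpoly set \<Rightarrow> ('v \<Rightarrow> 'w cpoly) \<Rightarrow> 'v cpoly set \<Rightarrow> bool"
  where "presented_by A g Rel \<longleftrightarrow>
    range (subst g) = A \<and> {p. subst g p = 0} = generated_ideal Rel"


section \<open>The action and its invariants\<close>

datatype var = A1 | A2 | B1 | B2

definition a :: "nat \<Rightarrow> var cpoly"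
  where "a i = (if i = 1 then Var A1 else if i = 2 then Var A2 else - Var A1 - Var A2)"

definition b :: "nat \<Rightarrow> var cpoly"
  where "b i = (if i = 1 then Var B1 else if i = 2 then Var B2 else - Var B1 - Var B2)"

text \<open>The library group \<^const>\<open>sign_img\<close> is the multiplicative group of the integers 1 and -1.\<close>

definition G2 :: "((nat \<Rightarrow> nat) \<times> int) monoid"
  where "G2 = sym_group 3 \<times>\<times> sign_img"

text \<open>
  The pair of \<open>\<sigma>\<close> and \<open>\<epsilon>\<close> sends \<open>a i\<close> to \<open>\<epsilon> a (\<sigma> i)\<close> and \<open>b i\<close> to \<open>\<epsilon> b (\<sigma> i)\<close>. It is enough to
  prescribe this for the variables: the case \<open>i = 3\<close> follows as \<open>a 1 + a 2 + a 3 = 0\<close>.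
\<close>

fun act_var :: "(nat \<Rightarrow> nat) \<times> int \<Rightarrow> var \<Rightarrow> var cpoly"
  where
    "act_var (\<sigma>, \<epsilon>) A1 = of_int \<epsilon> * a (\<sigma> 1)"
  | "act_var (\<sigma>, \<epsilon>) A2 = of_int \<epsilon> * a (\<sigma> 2)"
  | "act_var (\<sigma>, \<epsilon>) B1 = of_int \<epsilon> * b (\<sigma> 1)"
  | "act_var (\<sigma>, \<epsilon>) B2 = of_int \<epsilon> * b (\<sigma> 2)"

definition act :: "(nat \<Rightarrow> nat) \<times> int \<Rightarrow> var cpoly \<Rightarrow> var cpoly"
  where "act g = subst (act_var g)"

definition invariants :: "var cpoly set"
  where "invariants = {Q. \<forall>g\<in>carrier G2. act g Q = Q}"

definition S1 :: "var cpoly"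
  where "S1 = Const (- 1 / 9) * (a 1 * a 2 + a 2 * a 3 + a 1 * a 3)"

definition T1 :: "var cpoly"
  where "T1 = Const (- 1 / 9) * (a 1 * a 2 * a 3)"

definition U1 :: "var cpoly"
  where "U1 = Const (- 1 / 9) * (a 1 * b 1 ^ 2 + a 2 * b 2 ^ 2 + a 3 * b 3 ^ 2)"

definition S2 :: "var cpoly"
  where "S2 = Const (- 1 / 9) * (b 1 * b 2 + b 2 * b 3 + b 1 * b 3)"

definition T2 :: "var cpoly"
  where "T2 = Const (- 1 / 9) * (b 1 * b 2 * b 3)"

definition U2 :: "var cpoly"
  where "U2 = Const (- 1 / 9) * (a 1 ^ 2 * b 1 + a 2 ^ 2 * b 2 + a 3 ^ 2 * b 3)"

definition H :: "var cpoly"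
  where "H = Const (- 1 / 9) * (a 1 * b 1 + a 2 * b 2 + a 3 * b 3)"

definition T1' :: "var cpoly" where "T1' = T1 ^ 2"
definition T2' :: "var cpoly" where "T2' = T2 ^ 2"
definition Z :: "var cpoly" where "Z = T1 * T2"
definition U11 :: "var cpoly" where "U11 = T1 * U1"
definition U12 :: "var cpoly" where "U12 = T1 * U2"
definition U21 :: "var cpoly" where "U21 = T2 * U1"
definition U22 :: "var cpoly" where "U22 = T2 * U2"

definition R' :: "var cpoly set"
  where "R' = generated_algebra {S1, T1', S2, T2'}"


section \<open>The presentation\<close>

datatype gen = G_S1 | G_T1' | G_S2 | G_T2' | G_Z | G_H | G_U11 | G_U12 | G_U21 | G_U22

fun gen_val :: "gen \<Rightarrow> var cpoly"
  where
    "gen_val G_S1 = S1"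
  | "gen_val G_T1' = T1'"
  | "gen_val G_S2 = S2"
  | "gen_val G_T2' = T2'"
  | "gen_val G_Z = Z"
  | "gen_val G_H = H"
  | "gen_val G_U11 = U11"
  | "gen_val G_U12 = U12"
  | "gen_val G_U21 = U21"
  | "gen_val G_U22 = U22"

text \<open>A relation \<open>l = r\<close> is represented by the relator \<open>l - r\<close>.\<close>

definition relators :: "gen cpoly set"
  where "relators =
    (let s1 = Var G_S1; t1 = Var G_T1'; s2 = Var G_S2; t2 = Var G_T2'; z = Var G_Z; h = Var G_H;
         u11 = Var G_U11; u12 = Var G_U12; u21 = Var G_U21; u22 = Var G_U22
     in
      {z^2 - t1 * t2,
       h^4 - (- 4 * s1^2 * s2^2 - 3 * z * h + 5 * s1 * s2 * h^2 - s2 * u11 - s1 * u22),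
       h * u11 - (- 3 * s1 * z - s2 * u12),
       h * u12 - (- 3 * s2 * t1 - s1 * u11),
       h * u21 - (- 3 * s1 * t2 - s2 * u22),
       h * u22 - (- 3 * s2 * z - s1 * u21),
       u11^2 - (12 * s1 * s2^2 * t1 - 3 * s2 * t1 * h^2 + 3 * t1 * u22),
       u11 * u12 - (9 * z * t1 - 12 * s1 * s2 * t1 * h + 3 * t1 * h^3),
       u11 * u21 - (12 * s1 * s2^2 * z - 3 * s2 * z * h^2 + 3 * z * u22),
       u11 * u22 - (9 * z^2 - 12 * s1 * s2 * z * h + 3 * z * h^3),
       u12^2 - (12 * s1^2 * s2 * t1 - 3 * s1 * t1 * h^2 + 3 * t1 * u11),
       u12 * u21 - (9 * z^2 - 12 * s1 * s2 * z * h + 3 * z * h^3),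
       u12 * u22 - (12 * s1^2 * s2 * z - 3 * s1 * z * h^2 + 3 * z * u11),
       u21^2 - (12 * s1 * s2^2 * t2 - 3 * s2 * t2 * h^2 + 3 * t2 * u22),
       u21 * u22 - (9 * z * t2 - 12 * s1 * s2 * t2 * h + 3 * t2 * h^3),
       u22^2 - (12 * s1^2 * s2 * t2 - 3 * s1 * t2 * h^2 + 3 * t2 * u11),
       z * u11 - t1 * u21,
       z * u12 - t1 * u22,
       z * u21 - t2 * u11,
       z * u22 - t2 * u12})"

end

theory Submission
  imports Defs "HOL-Computational_Algebra.Polynomial"
begin

text \<open>
  In coordinates \<open>u, v\<close> (for the \<open>a i\<close>) and \<open>x, y\<close> (for the \<open>b i\<close>) that diagonalise the 3-cycle, the
  invariants are, up to scalars, \<open>S1 = uv\<close>, \<open>T1 = u^3 + v^3\<close>, \<open>S2 = xy\<close>, \<open>T2 = x^3 + y^3\<close>,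
  \<open>H = uy + vx\<close>, \<open>U1 = u x^2 + v y^2\<close>, \<open>U2 = u^2 x + v^2 y\<close>, and a transposition exchanges \<open>u, v\<close>
  and \<open>x, y\<close>. Averaging over \<open>A2\<close> turns a monomial into 0 or into the sum of the monomial and its mirror
  image; by induction on the degree these sums are polynomials in the seven elements above, of
  which the part of even degree lies in the algebra of the ten generators.

  The relations rewrite every polynomial in the ten generators to a combination of the twelve basis
  elements over \<open>\<complex>[s1, t1, s2, t2]\<close>. The coefficients are determined by the value in \<open>S\<close>: elements of
  \<open>R'\<close> are also invariant under the group acting on the \<open>a i\<close> alone, and the images of the equation
  under this group form a linear system that is nonsingular at generic points. Since
  \<open>(S1, T1', S2, T2')\<close> maps \<open>\<complex>^4\<close> onto \<open>\<complex>^4\<close>, these four elements are algebraically independent, so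
  the kernel of the evaluation is the ideal of the relations.
\<close>

section \<open>Evaluation of polynomials\<close>

lemma poly_mapping_add_induct [case_names single add]:
  fixes p :: "'m \<Rightarrow>\<^sub>0 'b::monoid_add"
  assumes single: "\<And>m c. P (Poly_Mapping.single m c)"
    and add: "\<And>p q. P p \<Longrightarrow> P q \<Longrightarrow> P (p + q)"
  shows "P p"
proof (induction p rule: update_induct)
  case const
  then show ?case using single[of undefined 0] by simp
next
  case (update p m c)
  have "Poly_Mapping.update m c p = Poly_Mapping.single m c + p"
    using update(1)
    by (intro poly_mapping_eqI) (auto simp: lookup_update lookup_add lookup_single in_keys_iff)
  then show ?case using add[OF single update(3)] by simp
qed

text \<open>The target ring is left open because both complex numbers and polynomials are
  substituted for the variables.\<close>

definition monom_val :: "('v \<Rightarrow> 'r::comm_semiring_1) \<Rightarrow> ('v \<Rightarrow>\<^sub>0 nat) \<Rightarrow> 'r"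
  where "monom_val f m = (\<Prod>v\<in>Poly_Mapping.keys m. f v ^ Poly_Mapping.lookup m v)"

lemma monom_val_superset:
  assumes "finite V" "Poly_Mapping.keys m \<subseteq> V"
  shows "monom_val f m = (\<Prod>v\<in>V. f v ^ Poly_Mapping.lookup m v)"
  unfolding monom_val_def
  by (rule prod.mono_neutral_left[OF assms]) (auto simp: in_keys_iff)

lemma monom_val_0 [simp]: "monom_val f 0 = 1"
  by (simp add: monom_val_def)

lemma monom_val_add: "monom_val f (m + n) = monom_val f m * monom_val f n"
proof -
  let ?V = "Poly_Mapping.keys m \<union> Poly_Mapping.keys n"
  have "monom_val f (m + n) = (\<Prod>v\<in>?V. f v ^ Poly_Mapping.lookup (m + n) v)"
    by (intro monom_val_superset Poly_Mapping.keys_add) auto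
  also have "\<dots> = (\<Prod>v\<in>?V. f v ^ Poly_Mapping.lookup m v) * (\<Prod>v\<in>?V. f v ^ Poly_Mapping.lookup n v)"
    by (simp add: lookup_add power_add prod.distrib)
  also have "\<dots> = monom_val f m * monom_val f n"
    by (intro arg_cong2[where f="(*)"] monom_val_superset[symmetric]) auto
  finally show ?thesis .
qed

lemma monom_val_single: "monom_val f (Poly_Mapping.single v n) = f v ^ n"
  by (cases "n = 0") (simp_all add: monom_val_def)

text \<open>Covers two evaluations at once: with \<open>Const\<close> for the scalars it yields
  substitution of polynomials, with the identity on the complex numbers the value at a
  point.\<close>

locale scalar_hom =
  fixes \<iota> :: "complex \<Rightarrow> 'r::comm_ring_1"
  assumes hom_one: "\<iota> 1 = 1"
    and hom_add: "\<iota> (c + d) = \<iota> c + \<iota> d"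
    and hom_mult: "\<iota> (c * d) = \<iota> c * \<iota> d"
begin

definition ev :: "('v \<Rightarrow> 'r) \<Rightarrow> 'v cpoly \<Rightarrow> 'r"
  where "ev f p = (\<Sum>m\<in>Poly_Mapping.keys p. \<iota> (Poly_Mapping.lookup p m) * monom_val f m)"

lemma hom_zero: "\<iota> 0 = 0"
  using hom_add[of 0 0] by simp

lemma ev_single [simp]: "ev f (Poly_Mapping.single m c) = \<iota> c * monom_val f m"
  by (cases "c = 0") (simp_all add: ev_def hom_zero)

lemma ev_0 [simp]: "ev f 0 = 0"
  by (simp add: ev_def)

lemma ev_add [simp]: "ev f (p + q) = ev f p + ev f q"
  unfolding ev_def
  by (intro setsum_keys_plus_distrib) (simp_all add: hom_zero hom_add distrib_right)

text \<open>Both sides are additive in each factor, and on scaled monomials convolution adds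
  exponents.\<close>

lemma ev_mult [simp]: "ev f (p * q) = ev f p * ev f q"
proof (induction p rule: poly_mapping_add_induct)
  case (single m c)
  show ?case
    by (induction q rule: poly_mapping_add_induct)
      (simp_all add: mult_single hom_mult monom_val_add algebra_simps)
qed (simp add: algebra_simps)

lemma ev_1 [simp]: "ev f 1 = 1"
  using ev_single[of f 0 1] by (simp add: hom_one del: ev_single)

lemma ev_uminus [simp]: "ev f (- p) = - ev f p"
  using ev_add[of f p "- p"] by (simp add: eq_neg_iff_add_eq_0 add.commute del: ev_add)

lemma ev_diff [simp]: "ev f (p - q) = ev f p - ev f q"
  using ev_add[of f p "- q"] by (simp del: ev_add)

lemma ev_power [simp]: "ev f (p ^ n) = ev f p ^ n"
  by (induction n) simp_all

lemma ev_prod: "ev f (prod g A) = (\<Prod>x\<in>A. ev f (g x))"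
  by (induction A rule: infinite_finite_induct) simp_all

lemma ev_monom_val: "ev f (monom_val s m) = monom_val (\<lambda>v. ev f (s v)) m"
  by (simp add: monom_val_def ev_prod)

lemma ev_numeral [simp]: "ev f (numeral n) = numeral n"
  by (induction n) (simp_all only: numeral.simps ev_add ev_1)

lemma ev_Var [simp]: "ev f (Var v) = f v"
  by (simp add: Var_def hom_one monom_val_single)

lemma ev_Const [simp]: "ev f (Const c) = \<iota> c"
  by (simp add: Const_def)

end

lemma Const_add: "Const (c + d) = Const c + Const d"
  by (simp add: Const_def single_add)

lemma Const_mult: "Const (c * d) = Const c * Const d"
  by (simp add: Const_def mult_single)

lemma Const_1 [simp]: "Const 1 = 1"
  by (simp add: Const_def)

lemma Const_0 [simp]: "Const 0 = 0"
  by (simp add: Const_def)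

lemma Const_minus: "Const (- c) = - Const c"
  by (simp add: Const_def single_uminus)

global_interpretation sub: scalar_hom "Const :: complex \<Rightarrow> 'w cpoly"
  by standard (simp_all add: Const_add Const_mult)

global_interpretation val: scalar_hom "\<lambda>c :: complex. c"
  defines eval_at = val.ev
  by standard simp_all

lemma subst_eq_ev: "subst f = sub.ev f"
  by (rule ext) (simp add: subst_def sub.ev_def monom_val_def)

lemma eval_at_subst: "eval_at f (subst s p) = eval_at (\<lambda>v. eval_at f (s v)) p"
  unfolding subst_eq_ev
  by (induction p rule: poly_mapping_add_induct) (simp_all add: val.ev_monom_val)

text \<open>Serves to move an element of a subalgebra between points at which its generators have
  equal values.\<close>

lemma eval_at_generated_cong:
  assumes "p \<in> generated_algebra X" "\<And>x. x \<in> X \<Longrightarrow> eval_at f x = eval_at g x"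
  shows "eval_at f p = eval_at g p"
  using assms(1) by induction (simp_all add: assms)

text \<open>
  Dedekind's argument: monomials are pairwise distinct characters of the multiplicative monoid
  of points.
\<close>

lemma monom_val_independent:
  fixes c :: "('v \<Rightarrow>\<^sub>0 nat) \<Rightarrow> complex"
  assumes "finite K" "\<And>f. (\<Sum>m\<in>K. c m * monom_val f m) = 0" "m \<in> K"
  shows "c m = 0"
  using assms
proof (induction "card K" arbitrary: K c m rule: less_induct)
  case less
  have one: "c n = 0" if "K = {n}" for n
    using less.prems(2)[of "\<lambda>_. 1"] that by (simp add: monom_val_def)
  show ?case
  proof (cases "K = {m}")
    case False
    then obtain n where n: "n \<in> K" "n \<noteq> m" using less.prems(3) by blast
    then obtain v where v: "Poly_Mapping.lookup n v \<noteq> Poly_Mapping.lookup m v"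
      by (metis poly_mapping_eqI)
    \<comment> \<open>Scaling one variable by 2 tells \<open>n\<close> and \<open>m\<close> apart,
      since their exponents there differ and powers of 2 are distinct.\<close>
    define g :: "'v \<Rightarrow> complex" where "g = (\<lambda>w. if w = v then 2 else 1)"
    have g: "monom_val g k = 2 ^ Poly_Mapping.lookup k v" for k
    proof -
      have "monom_val g k = (\<Prod>w\<in>insert v (Poly_Mapping.keys k). g w ^ Poly_Mapping.lookup k w)"
        by (intro monom_val_superset) auto
      also have "\<dots> = g v ^ Poly_Mapping.lookup k v * (\<Prod>w\<in>Poly_Mapping.keys k - {v}. 1)"
        by (subst prod.insert_remove) (auto simp: g_def)
      finally show ?thesis by (simp add: g_def)
    qed
    have mult: "monom_val (\<lambda>w. g w * f w) k = monom_val g k * monom_val f k" for f :: "'v \<Rightarrow> complex" and k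
      by (simp add: monom_val_def power_mult_distrib prod.distrib)
    \<comment> \<open>The relation at the scaled point minus \<open>monom_val g n\<close> times the
      original one loses its \<open>n\<close>-term and so is shorter.\<close>
    have "(\<Sum>k\<in>K - {n}. (c k * (monom_val g k - monom_val g n)) * monom_val f k) = 0" for f
    proof -
      have "(\<Sum>k\<in>K. (c k * (monom_val g k - monom_val g n)) * monom_val f k)
          = (\<Sum>k\<in>K. c k * monom_val (\<lambda>w. g w * f w) k)
            - monom_val g n * (\<Sum>k\<in>K. c k * monom_val f k)"
        unfolding mult by (simp add: sum_distrib_left sum_subtractf algebra_simps)
      also have "\<dots> = 0" using less.prems(2) by simp
      finally show ?thesis
        using less.prems(1) n(1) by (simp add: sum.remove)
    qed
    moreover have "card (K - {n}) < card K" "finite (K - {n})" "m \<in> K - {n}"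
      using n less.prems(1,3) card_Diff1_less[of K n] by auto
    ultimately have "c m * (monom_val g m - monom_val g n) = 0"
      using less.hyps[of "K - {n}" "\<lambda>k. c k * (monom_val g k - monom_val g n)" m] by blast
    moreover have "monom_val g m \<noteq> monom_val g n"
    proof
      assume "monom_val g m = monom_val g n"
      then have "of_nat (2 ^ Poly_Mapping.lookup m v) = (of_nat (2 ^ Poly_Mapping.lookup n v) :: complex)"
        by (simp add: g)
      then show False
        using v by (simp only: of_nat_eq_iff) simp
    qed
    ultimately show ?thesis by simp
  qed (rule one)
qed

section \<open>Polynomials as functions on points\<close>

lemma eval_at_zero_imp_zero:
  assumes "\<And>f. eval_at f p = 0"
  shows "p = 0"
proof (rule poly_mapping_eqI)
  fix m
  show "Poly_Mapping.lookup p m = Poly_Mapping.lookup 0 m"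
  proof (cases "m \<in> Poly_Mapping.keys p")
    case True
    show ?thesis
      using monom_val_independent[OF finite_keys _ True, of "Poly_Mapping.lookup p"] assms
      by (simp add: val.ev_def)
  qed (simp add: in_keys_iff)
qed

lemma eval_at_inject:
  assumes "\<And>f. eval_at f p = eval_at f q"
  shows "p = q"
  using eval_at_zero_imp_zero[of "p - q"] assms by simp

text \<open>Restriction to an affine line makes the facts on univariate polynomials
  available.\<close>

lemma eval_at_line:
  "\<exists>r :: complex poly. \<forall>t. eval_at (\<lambda>v. f v + t * g v) p = poly r t"
proof (induction p rule: poly_mapping_add_induct)
  case (single m c)
  have "eval_at (\<lambda>v. f v + t * g v) (Poly_Mapping.single m c)
      = poly (smult c (\<Prod>v\<in>Poly_Mapping.keys m. [:f v, g v:] ^ Poly_Mapping.lookup m v)) t" for t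
    by (simp add: monom_val_def poly_prod)
  then show ?case by blast
next
  case (add p q)
  then obtain r s where "\<forall>t. eval_at (\<lambda>v. f v + t * g v) p = poly r t"
    "\<forall>t. eval_at (\<lambda>v. f v + t * g v) q = poly s t" by blast
  then have "\<forall>t. eval_at (\<lambda>v. f v + t * g v) (p + q) = poly (r + s) t" by simp
  then show ?case by blast
qed

text \<open>On the line from \<open>f\<close> at parameter 0 to \<open>g\<close> at parameter 1 the
  product vanishes while \<open>q\<close> does not vanish identically, so \<open>p\<close> is zero
  along the line, in particular at \<open>f\<close>.\<close>

lemma eval_at_no_zero_divisors:
  assumes "\<And>f. eval_at f p * eval_at f q = 0" "eval_at g q \<noteq> 0"
  shows "p = 0"
proof (rule eval_at_zero_imp_zero)
  fix f
  obtain r s where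
    r: "\<And>t. eval_at (\<lambda>v. f v + t * (g v - f v)) p = poly r t" and
    s: "\<And>t. eval_at (\<lambda>v. f v + t * (g v - f v)) q = poly s t"
    using eval_at_line by metis
  have "poly (r * s) = poly 0"
    using assms(1) by (auto simp flip: r s)
  moreover have "s \<noteq> 0"
    using s[of 1] assms(2) by auto
  ultimately have "r = 0"
    by (simp add: poly_eq_poly_eq_iff)
  then show "eval_at f p = 0"
    using r[of 0] by simp
qed

section \<open>Diagonal coordinates and the relations\<close>

definition omega :: complex where "omega = Complex (- 1 / 2) (sqrt 3 / 2)"

lemma omega_square: "omega ^ 2 = - omega - 1"
  by (simp add: omega_def complex_eq_iff power2_eq_square)

lemma omega_cube: "omega ^ 3 = 1"
  using omega_square by algebra

text \<open>
  In the coordinates \<open>u, v\<close> with \<open>a 1 = u + v\<close>, \<open>a 2 = omega^2 u + omega v\<close>,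
  \<open>a 3 = omega u + omega^2 v\<close>, and likewise \<open>x, y\<close> for the \<open>b i\<close>, the 3-cycle acts diagonally.
\<close>

definition point :: "complex \<Rightarrow> complex \<Rightarrow> complex \<Rightarrow> complex \<Rightarrow> var \<Rightarrow> complex"
  where "point u v x y i = (case i of
      A1 \<Rightarrow> u + v | A2 \<Rightarrow> omega^2 * u + omega * v | B1 \<Rightarrow> x + y | B2 \<Rightarrow> omega^2 * x + omega * y)"

text \<open>The coordinates \<open>u\<close>, \<open>v\<close>, \<open>x\<close>, \<open>y\<close>
  as elements of S: the nontrivial components of the discrete Fourier transform of \<open>a\<close>
  and \<open>b\<close>.\<close>

definition pU :: "var cpoly" where "pU = Const (1/3) * (a 1 + Const omega * a 2 + Const (omega^2) * a 3)"
definition pV :: "var cpoly" where "pV = Const (1/3) * (a 1 + Const (omega^2) * a 2 + Const omega * a 3)"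
definition pX :: "var cpoly" where "pX = Const (1/3) * (b 1 + Const omega * b 2 + Const (omega^2) * b 3)"
definition pY :: "var cpoly" where "pY = Const (1/3) * (b 1 + Const (omega^2) * b 2 + Const omega * b 3)"

lemma eval_a:
  "eval_at (point u v x y) (a 1) = u + v"
  "eval_at (point u v x y) (a 2) = omega^2 * u + omega * v"
  "eval_at (point u v x y) (a 3) = omega * u + omega^2 * v"
  "eval_at (point u v x y) (b 1) = x + y"
  "eval_at (point u v x y) (b 2) = omega^2 * x + omega * y"
  "eval_at (point u v x y) (b 3) = omega * x + omega^2 * y"
  by (simp_all add: a_def b_def point_def omega_square algebra_simps)

lemma eval_coordinates [simp]:
  "eval_at (point u v x y) pU = u"
  "eval_at (point u v x y) pV = v"
  "eval_at (point u v x y) pX = x"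
  "eval_at (point u v x y) pY = y"
  using omega_square
  by (simp_all add: pU_def pV_def pX_def pY_def eval_a field_simps del: One_nat_def) algebra+

text \<open>The values of \<open>pU\<close>, \<open>pV\<close>, \<open>pX\<close>, \<open>pY\<close>
  at \<open>f\<close> are its diagonal coordinates. Hence an identity in S may be checked in these
  coordinates.\<close>

lemma point_cases: obtains u v x y where "f = point u v x y"
proof
  let ?f = "point (eval_at f pU) (eval_at f pV) (eval_at f pX) (eval_at f pY)"
  have eq: "f A1 = ?f A1" "f A2 = ?f A2" "f B1 = ?f B1" "f B2 = ?f B2"
    using omega_square
    by (simp_all add: point_def pU_def pV_def pX_def pY_def a_def b_def field_simps) algebra+
  have "f i = ?f i" for i
    using eq by (cases i) (simp_all add: point_def)
  then show "f = ?f" ..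
qed

lemma eval_point_inject:
  assumes "\<And>u v x y. eval_at (point u v x y) p = eval_at (point u v x y) q"
  shows "p = q"
  by (rule eval_at_inject) (metis assms point_cases)

lemma eval_basic [simp]:
  "eval_at (point u v x y) S1 = u * v / 3"
  "eval_at (point u v x y) S2 = x * y / 3"
  "eval_at (point u v x y) T1 = - (u^3 + v^3) / 9"
  "eval_at (point u v x y) T2 = - (x^3 + y^3) / 9"
  "eval_at (point u v x y) H = - (u * y + v * x) / 3"
  "eval_at (point u v x y) U1 = - (u * x^2 + v * y^2) / 3"
  "eval_at (point u v x y) U2 = - (u^2 * x + v^2 * y) / 3"
  using omega_square
  by (simp_all add: S1_def S2_def T1_def T2_def H_def U1_def U2_def eval_a field_simps del: One_nat_def) algebra+

text \<open>The relations of the presentation before multiplication by \<open>T1\<close> and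
  \<open>T2\<close>. They also show that products of \<open>U1\<close> and \<open>U2\<close> are
  polynomials in the ten generators.\<close>

lemma basic_relations:
  "H * U1 = - 3 * S1 * T2 - S2 * U2"
  "H * U2 = - 3 * S2 * T1 - S1 * U1"
  "U1^2 = 12 * S1 * S2^2 - 3 * S2 * H^2 + 3 * (T2 * U2)"
  "U2^2 = 12 * S1^2 * S2 - 3 * S1 * H^2 + 3 * (T1 * U1)"
  "U1 * U2 = 9 * (T1 * T2) - 12 * S1 * S2 * H + 3 * H^3"
  "H^4 = - 4 * S1^2 * S2^2 - 3 * (T1 * T2) * H + 5 * S1 * S2 * H^2 - S2 * (T1 * U1) - S1 * (T2 * U2)"
  by (rule eval_point_inject, simp add: field_simps power2_eq_square power3_eq_cube power4_eq_xxxx)+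

lemma subst_simps [simp]:
  "subst f (p + q) = subst f p + subst f q"
  "subst f (p * q) = subst f p * subst f q"
  "subst f (p - q) = subst f p - subst f q"
  "subst f (- p) = - subst f p"
  "subst f (p ^ n) = subst f p ^ n"
  "subst f (numeral k) = numeral k"
  "subst f (Var v) = f v"
  "subst f (Const c) = Const c"
  "subst f 0 = 0" "subst f 1 = 1"
  by (simp_all add: subst_eq_ev)

lemmas generator_defs = T1'_def T2'_def Z_def U11_def U12_def U21_def U22_def

lemma relators_hold: 
  assumes "r \<in> relators" shows "subst gen_val r = 0"
  using assms unfolding relators_def Let_def
  by (elim insertE emptyE; hypsubst; intro eval_point_inject; simp add: generator_defs;
      simp add: field_simps eval_nat_numeral)

section \<open>Independence\<close>

text \<open>
  The equation is averaged against the characters of the 3-cycle acting on \<open>(u', v')\<close>; together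
  with its image under the exchange of \<open>u\<close> and \<open>v\<close>, each of the three resulting equations
  is a linear system with nonzero determinant.
\<close>

lemma separate_invariant_coefficients:
  fixes u v x y :: complex
  assumes gen: "u^3 \<noteq> v^3" "x^3 \<noteq> y^3"
    and eq: "\<And>u' v'. u' * v' = u * v \<Longrightarrow> u'^3 + v'^3 = u^3 + v^3 \<Longrightarrow>
      c0 + c1 * (u' * y + v' * x) + c2 * (u' * y + v' * x)^2 + c3 * (u' * y + v' * x)^3
        + d1 * (u' * x^2 + v' * y^2) + d2 * (u'^2 * x + v'^2 * y) = 0"
  shows "c0 = 0 \<and> c1 = 0 \<and> c2 = 0 \<and> c3 = 0 \<and> d1 = 0 \<and> d2 = 0"
proof -
  \<comment> \<open>Expanding the powers of \<open>u' * y + v' * x\<close> with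
    \<open>u' * v' = u * v\<close>, the mixed terms of the cube join the linear term and that of the
    square joins the constant.\<close>
  define e where "e = c1 + 3 * c3 * (u * v * x * y)"
  define k where "k = c0 + 2 * c2 * (u * v * x * y)"
  define F where "F = (\<lambda>u' v'. c0 + c1 * (u' * y + v' * x) + c2 * (u' * y + v' * x)^2
    + c3 * (u' * y + v' * x)^3 + d1 * (u' * x^2 + v' * y^2) + d2 * (u'^2 * x + v'^2 * y))"
  have parts: "u' * (e * y + d1 * x^2) + v'^2 * (c2 * x^2 + d2 * y) = 0"
      "v' * (e * x + d1 * y^2) + u'^2 * (c2 * y^2 + d2 * x) = 0"
      "k + c3 * (u'^3 * y^3 + v'^3 * x^3) = 0"
    if "u' * v' = u * v" "u'^3 + v'^3 = u^3 + v^3" for u' v'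
  proof -
    let ?w = omega
    have w: "?w * ?w = - ?w - 1" using omega_square by (simp add: power2_eq_square)
    have w': "?w * (?w * z) = - ?w * z - z" for z
      using arg_cong[OF w, of "\<lambda>t. t * z"] by (simp add: algebra_simps)
    have cube: "(?w^2)^3 = 1" using omega_cube by algebra
    have F0: "F u' v' = 0" unfolding F_def by (rule eq) (use that in auto)
    have F1: "F (?w * u') (?w^2 * v') = 0" unfolding F_def
      by (rule eq) (use that omega_cube cube in \<open>auto simp: power_mult_distrib\<close>, algebra)
    have F2: "F (?w^2 * u') (?w * v') = 0" unfolding F_def
      by (rule eq) (use that omega_cube cube in \<open>auto simp: power_mult_distrib\<close>, algebra)
    \<comment> \<open>The multipliers cancel the factor \<open>omega\<close> picked up by
      \<open>u'\<close> and \<open>v'^2\<close>; the other weights drop out by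
      \<open>1 + omega + omega^2 = 0\<close>.\<close>
    have "3 * (u' * (e * y + d1 * x^2) + v'^2 * (c2 * x^2 + d2 * y))
        = F u' v' + ?w^2 * F (?w * u') (?w^2 * v') + ?w * F (?w^2 * u') (?w * v')"
      unfolding F_def e_def that(1)[symmetric]
      by (simp add: field_simps power2_eq_square power3_eq_cube w w')
    then show "u' * (e * y + d1 * x^2) + v'^2 * (c2 * x^2 + d2 * y) = 0"
      by (simp add: F0 F1 F2 del: distrib_left_numeral)
    have "3 * (v' * (e * x + d1 * y^2) + u'^2 * (c2 * y^2 + d2 * x))
        = F u' v' + ?w * F (?w * u') (?w^2 * v') + ?w^2 * F (?w^2 * u') (?w * v')"
      unfolding F_def e_def that(1)[symmetric]
      by (simp add: field_simps power2_eq_square power3_eq_cube w w')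
    then show "v' * (e * x + d1 * y^2) + u'^2 * (c2 * y^2 + d2 * x) = 0"
      by (simp add: F0 F1 F2 del: distrib_left_numeral)
    have "3 * (k + c3 * (u'^3 * y^3 + v'^3 * x^3))
        = F u' v' + F (?w * u') (?w^2 * v') + F (?w^2 * u') (?w * v')"
      unfolding F_def k_def that(1)[symmetric]
      by (simp add: field_simps power2_eq_square power3_eq_cube w w')
    then show "k + c3 * (u'^3 * y^3 + v'^3 * x^3) = 0"
      by (simp add: F0 F1 F2 del: distrib_left_numeral)
  qed
  note parts0 = parts[of u v, OF refl refl] and parts1 = parts[of v u, OF mult.commute add.commute]
  \<comment> \<open>Cramer's rule: \<open>u^3 - v^3\<close> is the determinant of an equation and
    its swapped form in the two bracketed unknowns.\<close>
  have "(u^3 - v^3) * (e * y + d1 * x^2) = 0" "(u^3 - v^3) * (c2 * x^2 + d2 * y) = 0"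
    using parts0(1) parts1(1) by algebra+
  then have 1: "e * y + d1 * x^2 = 0" "c2 * x^2 + d2 * y = 0" using gen by auto
  have "(u^3 - v^3) * (e * x + d1 * y^2) = 0" "(u^3 - v^3) * (c2 * y^2 + d2 * x) = 0"
    using parts0(2) parts1(2) by algebra+
  then have 2: "e * x + d1 * y^2 = 0" "c2 * y^2 + d2 * x = 0" using gen by auto
  \<comment> \<open>The brackets give two more systems, in \<open>e\<close>, \<open>d1\<close> and
    in \<open>c2\<close>, \<open>d2\<close>, with determinant \<open>x^3 - y^3\<close> up to
    sign.\<close>
  have "(x^3 - y^3) * d1 = 0" "(x^3 - y^3) * e = 0" "(x^3 - y^3) * c2 = 0" "(x^3 - y^3) * d2 = 0"
    using 1 2 by algebra+
  then have 3: "d1 = 0" "e = 0" "c2 = 0" "d2 = 0" using gen by auto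
  \<comment> \<open>Subtracting the swapped equation eliminates \<open>k\<close>.\<close>
  have "c3 * ((u^3 - v^3) * (x^3 - y^3)) = 0"
    using parts0(3) parts1(3) by algebra
  then have "c3 = 0" using gen by auto
  then show ?thesis
    using 3 parts0(3) by (simp add: e_def k_def)
qed

text \<open>\<open>S1\<close> sees only the product of the first two coordinates, and
  \<open>T1'\<close> sees \<open>T1\<close> only up to sign, so \<open>u\<close> and
  \<open>v\<close> may be moved while \<open>x\<close> and \<open>y\<close> stay fixed.\<close>

lemma eval_R'_cong:
  assumes "p \<in> R'" "u' * v' = u * v" "(u'^3 + v'^3)^2 = (u^3 + v^3)^2"
  shows "eval_at (point u' v' x y) p = eval_at (point u v x y) p"
proof (rule eval_at_generated_cong[OF assms(1)[unfolded R'_def]])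
  fix q assume "q \<in> {S1, T1', S2, T2'}"
  then show "eval_at (point u' v' x y) q = eval_at (point u v x y) q"
    using assms(2,3) by (auto simp: T1'_def T2'_def power_divide minus_add_distrib[symmetric] simp del: minus_add_distrib)
qed

text \<open>The excluded points are the zeros of the nonzero polynomial \<open>?q\<close>, and S has
  no zero divisors.\<close>

lemma generic_zero:
  assumes "\<And>u v x y. u^6 \<noteq> v^6 \<Longrightarrow> x^6 \<noteq> y^6 \<Longrightarrow> eval_at (point u v x y) p = 0"
  shows "p = 0"
proof (rule eval_at_no_zero_divisors)
  let ?q = "(pU^6 - pV^6) * (pX^6 - pY^6)"
  show "eval_at f p * eval_at f ?q = 0" for f
    by (cases f rule: point_cases) (use assms in auto)
  show "eval_at (point 1 0 1 0) ?q \<noteq> 0" by simp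
qed

text \<open>At a generic point the coefficients are constant along the orbit of
  \<open>(u, v)\<close>; the sign splits the equation into two with six unknowns each, to which
  \<open>separate_invariant_coefficients\<close> applies.\<close>

lemma normal_form_zero:
  assumes R: "{P0, P1, P2, P3, Q0, Q1, Q2, Q3, Q11, Q21, Q12, Q22} \<subseteq> R'"
    and eq: "P0 + P1 * H + P2 * H^2 + P3 * H^3 + Q0 * Z + Q1 * Z * H + Q2 * Z * H^2 + Q3 * Z * H^3
            + Q11 * U11 + Q21 * U21 + Q12 * U12 + Q22 * U22 = 0"
  shows "P0 = 0 \<and> P1 = 0 \<and> P2 = 0 \<and> P3 = 0 \<and> Q0 = 0 \<and> Q1 = 0 \<and> Q2 = 0 \<and> Q3 = 0 \<and>
    Q11 = 0 \<and> Q21 = 0 \<and> Q12 = 0 \<and> Q22 = 0"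
proof -
  have main: "eval_at (point u v x y) P0 = 0 \<and> eval_at (point u v x y) P1 = 0 \<and>
      eval_at (point u v x y) P2 = 0 \<and> eval_at (point u v x y) P3 = 0 \<and>
      eval_at (point u v x y) Q0 = 0 \<and> eval_at (point u v x y) Q1 = 0 \<and>
      eval_at (point u v x y) Q2 = 0 \<and> eval_at (point u v x y) Q3 = 0 \<and>
      eval_at (point u v x y) Q11 = 0 \<and> eval_at (point u v x y) Q21 = 0 \<and>
      eval_at (point u v x y) Q12 = 0 \<and> eval_at (point u v x y) Q22 = 0"
    if gen: "u^6 \<noteq> v^6" "x^6 \<noteq> y^6" for u v x y
  proof -
    define E where "E = (\<lambda>p. eval_at (point u v x y) p)"
    define t1 where "t1 = - (u^3 + v^3) / 9"
    define t2 where "t2 = - (x^3 + y^3) / 9"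
    \<comment> \<open>The sixth powers provide both the determinants of the linear systems and the
      nonvanishing of \<open>t1\<close> and \<open>t2\<close>, by which the coefficients are divided
      at the end.\<close>
    have "u^6 - v^6 = (u^3 - v^3) * (u^3 + v^3)" "x^6 - y^6 = (x^3 - y^3) * (x^3 + y^3)"
      by algebra+
    with gen have "u^3 - v^3 \<noteq> 0" "u^3 + v^3 \<noteq> 0" "x^3 - y^3 \<noteq> 0" "x^3 + y^3 \<noteq> 0"
      by (metis eq_iff_diff_eq_0 mult_eq_0_iff)+
    then have nz: "u^3 \<noteq> v^3" "x^3 \<noteq> y^3" "t1 \<noteq> 0" "t2 \<noteq> 0"
      by (simp_all add: t1_def t2_def del: minus_add_distrib)
    define h where "h = (\<lambda>u' v'. (- 1 / 3) * (u' * y + v' * x))"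
    define w1 where "w1 = (\<lambda>u' v'. (- 1 / 3) * (u' * x^2 + v' * y^2))"
    define w2 where "w2 = (\<lambda>u' v'. (- 1 / 3) * (u'^2 * x + v'^2 * y))"
    \<comment> \<open>The coefficients have the same values at all points of the orbit of \<open>(u, v)\<close>.\<close>
    have val: "E P0 + E P1 * h u' v' + E P2 * (h u' v')^2 + E P3 * (h u' v')^3
        + E Q0 * (t * t2) + E Q1 * (t * t2) * h u' v' + E Q2 * (t * t2) * (h u' v')^2
        + E Q3 * (t * t2) * (h u' v')^3 + E Q11 * (t * w1 u' v') + E Q21 * (t2 * w1 u' v')
        + E Q12 * (t * w2 u' v') + E Q22 * (t2 * w2 u' v') = 0"
      if "u' * v' = u * v" "(u'^3 + v'^3)^2 = (u^3 + v^3)^2" "t = - (u'^3 + v'^3) / 9" for u' v' t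
    proof -
      have "eval_at (point u' v' x y) p = E p" if "p \<in> R'" for p
        unfolding E_def using eval_R'_cong that \<open>u' * v' = u * v\<close> \<open>(u'^3 + v'^3)^2 = (u^3 + v^3)^2\<close>
        by blast
      then have c: "eval_at (point u' v' x y) P0 = E P0" "eval_at (point u' v' x y) P1 = E P1"
        "eval_at (point u' v' x y) P2 = E P2" "eval_at (point u' v' x y) P3 = E P3"
        "eval_at (point u' v' x y) Q0 = E Q0" "eval_at (point u' v' x y) Q1 = E Q1"
        "eval_at (point u' v' x y) Q2 = E Q2" "eval_at (point u' v' x y) Q3 = E Q3"
        "eval_at (point u' v' x y) Q11 = E Q11" "eval_at (point u' v' x y) Q21 = E Q21"
        "eval_at (point u' v' x y) Q12 = E Q12" "eval_at (point u' v' x y) Q22 = E Q22"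
        using R by simp_all
      have b: "eval_at (point u' v' x y) T1 = t" "eval_at (point u' v' x y) T2 = t2"
        "eval_at (point u' v' x y) H = h u' v'"
        "eval_at (point u' v' x y) U1 = w1 u' v'" "eval_at (point u' v' x y) U2 = w2 u' v'"
        by (simp_all add: that(3) t2_def h_def w1_def w2_def field_simps)
      show ?thesis
        using arg_cong[OF eq, of "eval_at (point u' v' x y)"]
        by (simp only: val.ev_add val.ev_mult val.ev_power val.ev_0 generator_defs c b)
    qed
    \<comment> \<open>The change of sign of \<open>(u', v')\<close> alone preserves the coefficients and separates the terms by their parity in the \<open>a i\<close>.\<close>
    have even_odd:
      "(E P0 + E P2 * (h u' v')^2 + E Q1 * (t1 * t2) * h u' v' + E Q3 * (t1 * t2) * (h u' v')^3
          + E Q11 * t1 * w1 u' v' + E Q22 * t2 * w2 u' v') = 0"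
      "(E Q0 * (t1 * t2) + E Q2 * (t1 * t2) * (h u' v')^2 + E P1 * h u' v' + E P3 * (h u' v')^3
          + E Q21 * t2 * w1 u' v' + E Q12 * t1 * w2 u' v') = 0"
      if *: "u' * v' = u * v" "u'^3 + v'^3 = u^3 + v^3" for u' v'
    proof -
      have neg: "h (- u') (- v') = - h u' v'" "w1 (- u') (- v') = - w1 u' v'"
        "w2 (- u') (- v') = w2 u' v'"
        by (simp_all add: h_def w1_def w2_def field_simps)
      have ns: "(- u')^3 + (- v')^3 = - (u^3 + v^3)" by (simp flip: *(2))
      have t: "t1 = - (u'^3 + v'^3) / 9" "- t1 = - ((- u')^3 + (- v')^3) / 9"
        by (simp_all only: t1_def *(2) ns minus_divide_left)
      have pos_val: "E P0 + E P1 * h u' v' + E P2 * (h u' v')^2 + E P3 * (h u' v')^3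
        + E Q0 * (t1 * t2) + E Q1 * (t1 * t2) * h u' v' + E Q2 * (t1 * t2) * (h u' v')^2
        + E Q3 * (t1 * t2) * (h u' v')^3 + E Q11 * (t1 * w1 u' v') + E Q21 * (t2 * w1 u' v')
        + E Q12 * (t1 * w2 u' v') + E Q22 * (t2 * w2 u' v') = 0"
        by (rule val) (use * t in simp_all)
      have "((- u')^3 + (- v')^3)^2 = (u^3 + v^3)^2" by (simp only: ns power2_minus)
      from val[OF _ this t(2)] * have neg_val:
        "E P0 - E P1 * h u' v' + E P2 * (h u' v')^2 - E P3 * (h u' v')^3
        - E Q0 * (t1 * t2) + E Q1 * (t1 * t2) * h u' v' - E Q2 * (t1 * t2) * (h u' v')^2
        + E Q3 * (t1 * t2) * (h u' v')^3 + E Q11 * (t1 * w1 u' v') - E Q21 * (t2 * w1 u' v')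
        - E Q12 * (t1 * w2 u' v') + E Q22 * (t2 * w2 u' v') = 0"
        by (simp add: neg)
      show "(E P0 + E P2 * (h u' v')^2 + E Q1 * (t1 * t2) * h u' v' + E Q3 * (t1 * t2) * (h u' v')^3
          + E Q11 * t1 * w1 u' v' + E Q22 * t2 * w2 u' v') = 0"
        using pos_val neg_val by algebra
      show "(E Q0 * (t1 * t2) + E Q2 * (t1 * t2) * (h u' v')^2 + E P1 * h u' v' + E P3 * (h u' v')^3
          + E Q21 * t2 * w1 u' v' + E Q12 * t1 * w2 u' v') = 0"
        using pos_val neg_val by algebra
    qed
    \<comment> \<open>The factors \<open>t1\<close>, \<open>t2\<close> and the powers of
      \<open>- 1 / 3\<close> are absorbed into the unknowns; none of them is zero.\<close>
    have "E P0 = 0 \<and> E Q1 * (t1 * t2) * (- 1 / 3) = 0 \<and> E P2 * (- 1 / 3)^2 = 0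
        \<and> E Q3 * (t1 * t2) * (- 1 / 3)^3 = 0 \<and> E Q11 * t1 * (- 1 / 3) = 0 \<and> E Q22 * t2 * (- 1 / 3) = 0"
      by (rule separate_invariant_coefficients[OF nz(1,2)], drule (1) even_odd(1))
        (simp only: h_def w1_def w2_def power_mult_distrib mult_ac add_ac)
    moreover have "E Q0 * (t1 * t2) = 0 \<and> E P1 * (- 1 / 3) = 0 \<and> E Q2 * (t1 * t2) * (- 1 / 3)^2 = 0
        \<and> E P3 * (- 1 / 3)^3 = 0 \<and> E Q21 * t2 * (- 1 / 3) = 0 \<and> E Q12 * t1 * (- 1 / 3) = 0"
      by (rule separate_invariant_coefficients[OF nz(1,2)], drule (1) even_odd(2))
        (simp only: h_def w1_def w2_def power_mult_distrib mult_ac add_ac)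
    ultimately show ?thesis
      using nz(3,4) by (simp add: E_def)
  qed
  show ?thesis
    by (intro conjI; rule generic_zero; simp add: main)
qed

section \<open>Algebraic independence of the four parameters\<close>

lemma complex_cube_root: "\<exists>w :: complex. w^3 = z"
proof -
  obtain r t where z: "z = rcis r t" using rcis_Ex by blast
  have "(rcis (root 3 r) (t / 3))^3 = z"
    by (simp add: DeMoivre2 z odd_real_root_pow)
  then show ?thesis by blast
qed

text \<open>Cardano's method: with \<open>r^2 = t\<close>, the cubes of \<open>u\<close> and
  \<open>v\<close> are the roots of \<open>X^2 - r X + s^3\<close>.\<close>

lemma elementary_invariants_surj: "\<exists>u v :: complex. u * v = s \<and> (u^3 + v^3)^2 = t"
proof -
  define r where "r = csqrt t"
  have r: "r^2 = t" by (simp add: r_def)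
  show ?thesis
  \<comment> \<open>For nonzero \<open>s\<close> the choice \<open>v = s / u\<close> fixes the cube
    root of the second root so that the product is right.\<close>
  proof (cases "s = 0")
    case True
    obtain u where "u^3 = r" using complex_cube_root by blast
    then have "u * 0 = s \<and> (u^3 + 0^3)^2 = t" using True r by simp
    then show ?thesis by blast
  next
    case False
    define d where "d = csqrt (r^2 - 4 * s^3)"
    have d: "d^2 = r^2 - 4 * s^3" by (simp add: d_def)
    obtain u where u: "u^3 = (r + d) / 2" using complex_cube_root by blast
    have prod: "u^3 * ((r - d) / 2) = s^3"
      unfolding u using d by (simp add: field_simps power2_eq_square)
    then have "u \<noteq> 0" using False by auto
    have "u^3 * (s / u)^3 = u^3 * ((r - d) / 2)"
      unfolding prod using \<open>u \<noteq> 0\<close> by (simp add: power_divide)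
    then have v: "(s / u)^3 = (r - d) / 2" using \<open>u \<noteq> 0\<close> by simp
    have "u^3 + (s / u)^3 = r"
      unfolding u v by (simp add: field_simps)
    then have "u * (s / u) = s \<and> (u^3 + (s / u)^3)^2 = t"
      using \<open>u \<noteq> 0\<close> r by simp
    then show ?thesis by blast
  qed
qed

text \<open>The counterpart of \<open>R'\<close> in the free algebra.\<close>

definition base :: "gen cpoly set"
  where "base = generated_algebra {Var G_S1, Var G_T1', Var G_S2, Var G_T2'}"

text \<open>Any prescribed values of the four variables are attained by \<open>S1\<close>,
  \<open>T1'\<close>, \<open>S2\<close>, \<open>T2'\<close> at some point, so every value of
  \<open>p\<close> is a value of its image.\<close>

lemma base_inject:
  assumes "p \<in> base" "subst gen_val p = 0"
  shows "p = 0"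
proof (rule eval_at_zero_imp_zero)
  fix f :: "gen \<Rightarrow> complex"
  \<comment> \<open>The constants 3 and 81 clear the denominators in \<open>S1 = u v / 3\<close> and
    \<open>T1' = (u^3 + v^3)^2 / 81\<close>.\<close>
  obtain u v where uv: "u * v = 3 * f G_S1" "(u^3 + v^3)^2 = 81 * f G_T1'"
    using elementary_invariants_surj by blast
  obtain x y where xy: "x * y = 3 * f G_S2" "(x^3 + y^3)^2 = 81 * f G_T2'"
    using elementary_invariants_surj by blast
  have "eval_at f p = eval_at (\<lambda>g. eval_at (point u v x y) (gen_val g)) p"
  proof (rule eval_at_generated_cong[OF assms(1)[unfolded base_def]])
    fix q :: "gen cpoly"
    assume "q \<in> {Var G_S1, Var G_T1', Var G_S2, Var G_T2'}"
    then show "eval_at f q = eval_at (\<lambda>g. eval_at (point u v x y) (gen_val g)) q"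
      using uv xy by (auto simp: T1'_def T2'_def power_divide simp del: minus_add_distrib)
  qed
  then show "eval_at f p = 0"
    using assms(2) by (simp flip: eval_at_subst)
qed

section \<open>Normal forms modulo the relations\<close>

lemma generated_algebra_0: "0 \<in> generated_algebra X"
  using generated_algebra.const[of 0] by simp

lemma generated_algebra_1: "1 \<in> generated_algebra X"
  using generated_algebra.const[of 1] by simp

lemma generated_algebra_uminus: "p \<in> generated_algebra X \<Longrightarrow> - p \<in> generated_algebra X"
  using generated_algebra.mult[OF generated_algebra.const[of "- 1"]] by (fastforce simp: Const_minus)

lemma generated_algebra_diff:
  "p \<in> generated_algebra X \<Longrightarrow> q \<in> generated_algebra X \<Longrightarrow> p - q \<in> generated_algebra X"
  using generated_algebra.add[OF _ generated_algebra_uminus] by fastforce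

lemma generated_algebra_power: "p \<in> generated_algebra X \<Longrightarrow> p ^ n \<in> generated_algebra X"
  by (induction n) (auto intro: generated_algebra_1 generated_algebra.mult)

lemma generated_algebra_numeral: "numeral k \<in> generated_algebra X"
  by (induction k)
    (auto simp only: numeral.simps intro: generated_algebra_1 generated_algebra.add)

lemma generated_algebra_sum:
  "(\<And>x. x \<in> A \<Longrightarrow> f x \<in> generated_algebra X) \<Longrightarrow> sum f A \<in> generated_algebra X"
  by (induction A rule: infinite_finite_induct)
    (auto intro: generated_algebra_0 generated_algebra.add)

lemma generated_algebra_prod:
  "(\<And>x. x \<in> A \<Longrightarrow> f x \<in> generated_algebra X) \<Longrightarrow> prod f A \<in> generated_algebra X"
  by (induction A rule: infinite_finite_induct)
    (auto intro: generated_algebra_1 generated_algebra.mult)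

lemmas generated_algebra_intros = generated_algebra.const generated_algebra.add generated_algebra.mult
  generated_algebra_0 generated_algebra_1 generated_algebra_uminus generated_algebra_diff
  generated_algebra_power generated_algebra_numeral generated_algebra_sum generated_algebra_prod

lemma subst_generated_algebra:
  "p \<in> generated_algebra X \<Longrightarrow> subst f p \<in> generated_algebra (subst f ` X)"
  by (induction rule: generated_algebra.induct)
    (auto intro: generated_algebra_intros generated_algebra.gen)

lemma generated_algebra_Var: "p \<in> generated_algebra (range Var)"
proof -
  have "p = subst Var p"
    by (rule eval_at_inject) (simp add: eval_at_subst)
  moreover have "subst Var p \<in> generated_algebra (range Var)"
    unfolding subst_def by (intro generated_algebra_intros generated_algebra.gen) auto
  ultimately show ?thesis by simp
qed

lemma range_subst: "range (subst f) = generated_algebra (range f)"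
proof
  show "range (subst f) \<subseteq> generated_algebra (range f)"
    using subst_generated_algebra[OF generated_algebra_Var, of f] by (auto simp: image_image)
  show "generated_algebra (range f) \<subseteq> range (subst f)"
  proof
    fix q assume "q \<in> generated_algebra (range f)"
    then show "q \<in> range (subst f)"
    proof induction
      case (const c)
      show ?case using rangeI[of "subst f" "Const c"] by simp
    next
      case (gen x)
      then obtain v where "x = f v" by blast
      then show ?case using rangeI[of "subst f" "Var v"] by simp
    next
      case (add p q)
      then obtain p' q' where "p = subst f p'" "q = subst f q'" by blast
      then show ?case using rangeI[of "subst f" "p' + q'"] by simp
    next
      case (mult p q)
      then obtain p' q' where "p = subst f p'" "q = subst f q'" by blast
      then show ?case using rangeI[of "subst f" "p' * q'"] by simp
    qed
  qed
qed

lemma module_mult: "module ((*) :: 'v cpoly \<Rightarrow> 'v cpoly \<Rightarrow> 'v cpoly)"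
  by unfold_locales (simp_all add: algebra_simps)

section \<open>Rewriting by the relations\<close>

abbreviation "s1 \<equiv> Var G_S1"
abbreviation "t1 \<equiv> Var G_T1'"
abbreviation "s2 \<equiv> Var G_S2"
abbreviation "t2 \<equiv> Var G_T2'"
abbreviation "z \<equiv> Var G_Z"
abbreviation "h \<equiv> Var G_H"
abbreviation "u11 \<equiv> Var G_U11"
abbreviation "u12 \<equiv> Var G_U12"
abbreviation "u21 \<equiv> Var G_U21"
abbreviation "u22 \<equiv> Var G_U22"

abbreviation "relation_ideal \<equiv> generated_ideal relators"

lemma relation_ideal:
  "z^2 - t1 * t2 \<in> relation_ideal"
  "h^4 - (- 4 * s1^2 * s2^2 - 3 * z * h + 5 * s1 * s2 * h^2 - s2 * u11 - s1 * u22) \<in> relation_ideal"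
  "h * u11 - (- 3 * s1 * z - s2 * u12) \<in> relation_ideal"
  "h * u12 - (- 3 * s2 * t1 - s1 * u11) \<in> relation_ideal"
  "h * u21 - (- 3 * s1 * t2 - s2 * u22) \<in> relation_ideal"
  "h * u22 - (- 3 * s2 * z - s1 * u21) \<in> relation_ideal"
  "u11^2 - (12 * s1 * s2^2 * t1 - 3 * s2 * t1 * h^2 + 3 * t1 * u22) \<in> relation_ideal"
  "u11 * u12 - (9 * z * t1 - 12 * s1 * s2 * t1 * h + 3 * t1 * h^3) \<in> relation_ideal"
  "u11 * u21 - (12 * s1 * s2^2 * z - 3 * s2 * z * h^2 + 3 * z * u22) \<in> relation_ideal"
  "u11 * u22 - (9 * z^2 - 12 * s1 * s2 * z * h + 3 * z * h^3) \<in> relation_ideal"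
  "u12^2 - (12 * s1^2 * s2 * t1 - 3 * s1 * t1 * h^2 + 3 * t1 * u11) \<in> relation_ideal"
  "u12 * u21 - (9 * z^2 - 12 * s1 * s2 * z * h + 3 * z * h^3) \<in> relation_ideal"
  "u12 * u22 - (12 * s1^2 * s2 * z - 3 * s1 * z * h^2 + 3 * z * u11) \<in> relation_ideal"
  "u21^2 - (12 * s1 * s2^2 * t2 - 3 * s2 * t2 * h^2 + 3 * t2 * u22) \<in> relation_ideal"
  "u21 * u22 - (9 * z * t2 - 12 * s1 * s2 * t2 * h + 3 * t2 * h^3) \<in> relation_ideal"
  "u22^2 - (12 * s1^2 * s2 * t2 - 3 * s1 * t2 * h^2 + 3 * t2 * u11) \<in> relation_ideal"
  "z * u11 - t1 * u21 \<in> relation_ideal"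
  "z * u12 - t1 * u22 \<in> relation_ideal"
  "z * u21 - t2 * u11 \<in> relation_ideal"
  "z * u22 - t2 * u12 \<in> relation_ideal"
  unfolding generated_ideal_def by (rule module.span_base[OF module_mult], simp only: relators_def Let_def, blast)+

text \<open>Listed in the order of the coefficients in the normal form: \<open>P0\<close> to
  \<open>P3\<close>, \<open>Q0\<close> to \<open>Q3\<close>, \<open>Q11\<close>, \<open>Q21\<close>,
  \<open>Q12\<close>, \<open>Q22\<close>.\<close>

definition nf_basis :: "gen cpoly list"
  where "nf_basis = [1, h, h^2, h^3, z, z * h, z * h^2, z * h^3, u11, u21, u12, u22]"

lemma length_nf_basis: "length nf_basis = 12"
  by (simp add: nf_basis_def)

text \<open>The relation ideal plus the span of \<open>nf_basis\<close> over \<open>base\<close>. It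
  turns out to be closed under multiplication by every variable and hence to be the whole free
  algebra.\<close>

inductive_set nf :: "gen cpoly set"
  where
    ideal: "p \<in> relation_ideal \<Longrightarrow> p \<in> nf"
  | basis: "c \<in> base \<Longrightarrow> e \<in> set nf_basis \<Longrightarrow> c * e \<in> nf"
  | add: "p \<in> nf \<Longrightarrow> q \<in> nf \<Longrightarrow> p + q \<in> nf"

lemma ideal_mult: "p \<in> relation_ideal \<Longrightarrow> q * p \<in> relation_ideal"
  unfolding generated_ideal_def by (rule module.span_scale[OF module_mult])

lemma base_Var: "s1 \<in> base" "t1 \<in> base" "s2 \<in> base" "t2 \<in> base"
  by (auto simp: base_def intro: generated_algebra.gen)

lemmas base_intros = generated_algebra_intros[where X = "{s1, t1, s2, t2}", folded base_def]

lemma nf_base_mult: "p \<in> nf \<Longrightarrow> c \<in> base \<Longrightarrow> c * p \<in> nf"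
proof (induction rule: nf.induct)
  case (basis d e)
  then show ?case using nf.basis[of "c * d" e] by (simp add: mult.assoc base_def generated_algebra.mult)
qed (auto simp: distrib_left intro: nf.intros ideal_mult)

text \<open>One rewriting step: \<open>q\<close> is the right side of a relation, and
  \<open>q'\<close> is the same polynomial sorted into coefficients times basis elements.\<close>

lemma nf_cong: "p - q \<in> relation_ideal \<Longrightarrow> q = q' \<Longrightarrow> q' \<in> nf \<Longrightarrow> p \<in> nf"
  using nf.add[OF nf.ideal, of "p - q" q] by simp

lemmas nf_intros = nf.add nf.basis base_intros base_Var

lemma nf_basis_in_nf: "e \<in> set nf_basis \<Longrightarrow> e \<in> nf"
  using nf.basis[OF base_intros(5)] by simp

lemma nf_mult_closed:
  assumes "\<And>e. e \<in> set nf_basis \<Longrightarrow> q * e \<in> nf" "p \<in> nf"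
  shows "q * p \<in> nf"
  using assms(2)
proof induction
  case (basis c e)
  then show ?case
    using nf_base_mult[OF assms(1)[of e], of c] by (simp add: mult_ac)
qed (auto simp: distrib_left intro: nf.intros ideal_mult)

text \<open>
  Closure under \<open>z\<close> has to come first, since rewriting \<open>z h^4\<close> produces \<open>z^2\<close> and \<open>z u\<close>; closure
  under the \<open>u\<close> then needs only the products of two of them.
\<close>

lemma nf_z: "p \<in> nf \<Longrightarrow> z * p \<in> nf"
proof (rule nf_mult_closed)
  fix e assume e: "e \<in> set nf_basis"
  have zz: "z * (z * q) \<in> nf" if "q \<in> set nf_basis" for q
  proof (rule nf_cong)
    show "z * (z * q) - (t1 * t2) * q \<in> relation_ideal"
      using ideal_mult[OF relation_ideal(1), of q] by (simp add: algebra_simps power2_eq_square)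
    show "(t1 * t2) * q \<in> nf" using that by (intro nf_intros)
  qed (rule refl)
  have u: "z * u11 \<in> nf" "z * u12 \<in> nf" "z * u21 \<in> nf" "z * u22 \<in> nf"
    by (rule nf_cong[OF relation_ideal(17) refl] nf_cong[OF relation_ideal(18) refl]
        nf_cong[OF relation_ideal(19) refl] nf_cong[OF relation_ideal(20) refl],
        intro nf_intros, simp add: nf_basis_def)+
  have 1: "z * 1 \<in> nf" "z * h \<in> nf" "z * h^2 \<in> nf" "z * h^3 \<in> nf"
    by (rule nf_basis_in_nf, simp add: nf_basis_def)+
  have 2: "z * z \<in> nf" "z * (z * h) \<in> nf" "z * (z * h^2) \<in> nf" "z * (z * h^3) \<in> nf"
    using zz[of 1] zz[of h] zz[of "h^2"] zz[of "h^3"] by (simp_all add: nf_basis_def)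
  show "z * e \<in> nf"
    using e u 1 2 by (auto simp: nf_basis_def)
qed

text \<open>Only \<open>h^4\<close> and the products of \<open>h\<close> with the \<open>u\<close>
  need a relation; the case \<open>z h^4\<close> is left to \<open>nf_z\<close>.\<close>

lemma nf_h: "p \<in> nf \<Longrightarrow> h * p \<in> nf"
proof (rule nf_mult_closed)
  fix e assume e: "e \<in> set nf_basis"
  have h4: "h^4 \<in> nf"
    by (rule nf_cong[OF relation_ideal(2), of "(- 4 * s1^2 * s2^2) * 1 + (- 3) * (z * h)
      + (5 * s1 * s2) * h^2 + (- s2) * u11 + (- s1) * u22"])
      (simp add: algebra_simps, (intro nf_intros; simp add: nf_basis_def))
  have u11: "h * u11 \<in> nf"
    by (rule nf_cong[OF relation_ideal(3), of "(- 3 * s1) * z + (- s2) * u12"])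
      (simp add: algebra_simps, (intro nf_intros; simp add: nf_basis_def))
  have u12: "h * u12 \<in> nf"
    by (rule nf_cong[OF relation_ideal(4), of "(- 3 * s2 * t1) * 1 + (- s1) * u11"])
      (simp add: algebra_simps, (intro nf_intros; simp add: nf_basis_def))
  have u21: "h * u21 \<in> nf"
    by (rule nf_cong[OF relation_ideal(5), of "(- 3 * s1 * t2) * 1 + (- s2) * u22"])
      (simp add: algebra_simps, (intro nf_intros; simp add: nf_basis_def))
  have u22: "h * u22 \<in> nf"
    by (rule nf_cong[OF relation_ideal(6), of "(- 3 * s2) * z + (- s1) * u21"])
      (simp add: algebra_simps, (intro nf_intros; simp add: nf_basis_def))
  have 1: "h * 1 \<in> nf" "h^2 \<in> nf" "h^3 \<in> nf"
    by (rule nf_basis_in_nf, simp add: nf_basis_def)+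
  have p: "h * h = h^2" "h * h^2 = h^3" "h * h^3 = h^4"
    "h * z = z * h" "h * (z * h) = z * h^2" "h * (z * h^2) = z * h^3" "h * (z * h^3) = z * h^4"
    by (simp_all add: eval_nat_numeral mult_ac)
  show "h * e \<in> nf"
    using e u11 u12 u21 u22 1 h4 nf_z[OF h4] nf_z[OF 1(1)] nf_z[OF 1(2)] nf_z[OF 1(3)] by (auto simp: nf_basis_def p)
qed

lemma nf_u_products:
  "u11 * u11 \<in> nf" "u11 * u12 \<in> nf" "u11 * u21 \<in> nf" "u11 * u22 \<in> nf" "u12 * u12 \<in> nf"
  "u12 * u21 \<in> nf" "u12 * u22 \<in> nf" "u21 * u21 \<in> nf" "u21 * u22 \<in> nf" "u22 * u22 \<in> nf"
proof -
  note rel = relation_ideal(7-16)[unfolded power2_eq_square[of u11] power2_eq_square[of u12]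
      power2_eq_square[of u21] power2_eq_square[of u22]]
  \<comment> \<open>Two of the right sides still contain \<open>z^2\<close>, which the first
    relation replaces by \<open>t1 * t2\<close>.\<close>
  have zz: "9 * z^2 - 12 * s1 * s2 * z * h + 3 * z * h^3 \<in> nf"
  proof (rule nf_cong)
    show "(9 * z^2 - 12 * s1 * s2 * z * h + 3 * z * h^3)
        - (9 * (t1 * t2) - 12 * s1 * s2 * z * h + 3 * z * h^3) \<in> relation_ideal"
      using ideal_mult[OF relation_ideal(1), of 9] by (simp add: algebra_simps)
    show "9 * (t1 * t2) - 12 * s1 * s2 * z * h + 3 * z * h^3
        = (9 * t1 * t2) * 1 + (- 12 * s1 * s2) * (z * h) + 3 * (z * h^3)"
      by (simp add: algebra_simps)
  qed (intro nf_intros; simp add: nf_basis_def)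
  show "u11 * u11 \<in> nf"
    by (rule nf_cong[OF rel(1), of "(12 * s1 * s2^2 * t1) * 1 + (- 3 * s2 * t1) * h^2 + (3 * t1) * u22"])
      (simp add: algebra_simps, (intro nf_intros; simp add: nf_basis_def))
  show "u11 * u12 \<in> nf"
    by (rule nf_cong[OF rel(2), of "(9 * t1) * z + (- 12 * s1 * s2 * t1) * h + (3 * t1) * h^3"])
      (simp add: algebra_simps, (intro nf_intros; simp add: nf_basis_def))
  \<comment> \<open>Here the right side is \<open>z\<close> times a normal form, so
    \<open>nf_z\<close> finishes.\<close>
  show "u11 * u21 \<in> nf"
    by (rule nf_cong[OF rel(3) _ nf_z, of "(12 * s1 * s2^2) * 1 + (- 3 * s2) * h^2 + 3 * u22"])
      (simp add: algebra_simps, (intro nf_intros; simp add: nf_basis_def))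
  show "u11 * u22 \<in> nf"
    by (rule nf_cong[OF rel(4) refl zz])
  show "u12 * u12 \<in> nf"
    by (rule nf_cong[OF rel(5), of "(12 * s1^2 * s2 * t1) * 1 + (- 3 * s1 * t1) * h^2 + (3 * t1) * u11"])
      (simp add: algebra_simps, (intro nf_intros; simp add: nf_basis_def))
  show "u12 * u21 \<in> nf"
    by (rule nf_cong[OF rel(6) refl zz])
  show "u12 * u22 \<in> nf"
    by (rule nf_cong[OF rel(7) _ nf_z, of "(12 * s1^2 * s2) * 1 + (- 3 * s1) * h^2 + 3 * u11"])
      (simp add: algebra_simps, (intro nf_intros; simp add: nf_basis_def))
  show "u21 * u21 \<in> nf"
    by (rule nf_cong[OF rel(8), of "(12 * s1 * s2^2 * t2) * 1 + (- 3 * s2 * t2) * h^2 + (3 * t2) * u22"])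
      (simp add: algebra_simps, (intro nf_intros; simp add: nf_basis_def))
  show "u21 * u22 \<in> nf"
    by (rule nf_cong[OF rel(9), of "(9 * t2) * z + (- 12 * s1 * s2 * t2) * h + (3 * t2) * h^3"])
      (simp add: algebra_simps, (intro nf_intros; simp add: nf_basis_def))
  show "u22 * u22 \<in> nf"
    by (rule nf_cong[OF rel(10), of "(12 * s1^2 * s2 * t2) * 1 + (- 3 * s1 * t2) * h^2 + (3 * t2) * u11"])
      (simp add: algebra_simps, (intro nf_intros; simp add: nf_basis_def))
qed

text \<open>Powers of \<open>h\<close> and \<open>z\<close> are moved to the outside, where closure
  is known; what remains is \<open>q\<close> itself or a product of two of the
  \<open>u\<close>.\<close>

lemma nf_u:
  assumes "q \<in> {u11, u12, u21, u22}" "p \<in> nf"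
  shows "q * p \<in> nf"
proof (rule nf_mult_closed[OF _ assms(2)])
  fix e assume e: "e \<in> set nf_basis"
  have "q \<in> nf" using assms(1) by (auto intro: nf_basis_in_nf simp: nf_basis_def)
  then have h: "h * q \<in> nf" "h * (h * q) \<in> nf" "h * (h * (h * q)) \<in> nf"
    by (simp_all add: nf_h)
  have p: "q * h = h * q" "q * h^2 = h * (h * q)" "q * h^3 = h * (h * (h * q))"
    "q * z = z * q" "q * (z * h) = z * (h * q)" "q * (z * h^2) = z * (h * (h * q))"
    "q * (z * h^3) = z * (h * (h * (h * q)))"
    by (simp_all add: eval_nat_numeral mult_ac)
  have "q * u11 \<in> nf" "q * u12 \<in> nf" "q * u21 \<in> nf" "q * u22 \<in> nf"
    using assms(1) nf_u_products by (auto simp: mult.commute)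
  then show "q * e \<in> nf"
    using e \<open>q \<in> nf\<close> h nf_z[OF h(1)] nf_z[OF h(2)] nf_z[OF h(3)] nf_z[OF \<open>q \<in> nf\<close>]
    by (auto simp: nf_basis_def p)
qed

lemma nf_mult: "q * p \<in> nf" if "p \<in> nf"
  using generated_algebra_Var[of q] that
proof (induction arbitrary: p)
  case (const c)
  then show ?case using nf_base_mult base_intros(1) by blast
next
  case (gen x)
  then obtain g where "x = Var g" by blast
  with gen(2) show ?case
    by (cases g) (auto intro: nf_base_mult base_Var nf_z nf_h nf_u)
next
  case (add q r)
  then show ?case by (simp add: distrib_right nf.add)
next
  case (mult q r)
  then show ?case by (simp add: mult.assoc)
qed

lemma normal_form_modulo_relations:
  "\<exists>i\<in>relation_ideal. \<exists>c. range c \<subseteq> base \<and> p = i + (\<Sum>k<12. c k * nf_basis ! k)"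
proof -
  \<comment> \<open>The constant 1 is a basis element, and \<open>p = p * 1\<close>.\<close>
  have "p \<in> nf"
    using nf_mult[of 1 p] nf_basis_in_nf[of 1] by (simp add: nf_basis_def)
  then show ?thesis
  proof induction
    case (ideal p)
    then show ?case by (intro bexI[of _ p] exI[of _ "\<lambda>_. 0"]) (auto intro: base_intros)
  next
    case (basis c e)
    then obtain n where n: "n < 12" "e = nf_basis ! n"
      by (metis in_set_conv_nth length_nf_basis)
    have "(\<Sum>k<12. (if k = n then c else 0) * nf_basis ! k) = (\<Sum>k<12. if k = n then c * nf_basis ! k else 0)"
      by (rule sum.cong) auto
    also have "\<dots> = c * e" using n by (simp add: sum.delta)
    finally have "c * e = 0 + (\<Sum>k<12. (if k = n then c else 0) * nf_basis ! k)" by simp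
    moreover have "range (\<lambda>k. if k = n then c else 0) \<subseteq> base"
      using basis(1) by (auto intro: base_intros)
    moreover have "0 \<in> relation_ideal"
      unfolding generated_ideal_def by (rule module.span_zero[OF module_mult])
    ultimately show ?case by blast
  next
    case (add p q)
    then obtain i c j d where
      "i \<in> relation_ideal" "range c \<subseteq> base" "p = i + (\<Sum>k<12. c k * nf_basis ! k)"
      "j \<in> relation_ideal" "range d \<subseteq> base" "q = j + (\<Sum>k<12. d k * nf_basis ! k)" by blast
    moreover from this have "i + j \<in> relation_ideal"
      unfolding generated_ideal_def by (intro module.span_add[OF module_mult])
    ultimately show ?case
      by (intro bexI[of _ "i + j"] exI[of _ "\<lambda>k. c k + d k"])
        (auto simp: distrib_right sum.distrib intro!: base_intros)
  qed
qed

section \<open>The kernel of the evaluation\<close>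

lemma relation_ideal_subset_kernel:
  assumes "p \<in> relation_ideal"
  shows "subst gen_val p = 0"
proof -
  have "module.subspace (*) {p. subst gen_val p = 0}"
    by (rule module.subspaceI[OF module_mult]) simp_all
  then have "module.span (*) relators \<subseteq> {p. subst gen_val p = 0}"
    using relators_hold by (intro module.span_minimal[OF module_mult]) auto
  then show ?thesis using assms by (auto simp: generated_ideal_def)
qed

lemma subst_base: "c \<in> base \<Longrightarrow> subst gen_val c \<in> R'"
  using subst_generated_algebra[of c _ gen_val] by (fastforce simp: base_def R'_def)

lemma subst_normal_form:
  "subst gen_val (\<Sum>k<12. c k * nf_basis ! k) =
    subst gen_val (c 0) + subst gen_val (c 1) * H + subst gen_val (c 2) * H^2
    + subst gen_val (c 3) * H^3 + subst gen_val (c 4) * Z + subst gen_val (c 5) * Z * H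
    + subst gen_val (c 6) * Z * H^2 + subst gen_val (c 7) * Z * H^3
    + subst gen_val (c 8) * U11 + subst gen_val (c 9) * U21 + subst gen_val (c 10) * U12
    + subst gen_val (c 11) * U22"
  by (simp add: eval_nat_numeral lessThan_Suc nf_basis_def algebra_simps del: power_Suc)

text \<open>For \<open>p\<close> in the kernel the coefficients of its normal form evaluate to 0 by
  \<open>normal_form_zero\<close>, so they are 0 by \<open>base_inject\<close>, and only the ideal
  part of \<open>p\<close> is left.\<close>

lemma kernel_gen_val: "{p. subst gen_val p = 0} = relation_ideal"
proof
  show "relation_ideal \<subseteq> {p. subst gen_val p = 0}"
    using relation_ideal_subset_kernel by auto
  show "{p. subst gen_val p = 0} \<subseteq> relation_ideal"
  proof
    fix p assume "p \<in> {p. subst gen_val p = 0}"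
    moreover obtain i c where i: "i \<in> relation_ideal" "range c \<subseteq> base"
      "p = i + (\<Sum>k<12. c k * nf_basis ! k)"
      using normal_form_modulo_relations by blast
    ultimately have "subst gen_val (\<Sum>k<12. c k * nf_basis ! k) = 0"
      using relation_ideal_subset_kernel by simp
    note normal_form_zero[OF _ this[unfolded subst_normal_form]]
    moreover have R: "subst gen_val (c k) \<in> R'" for k
      using i(2) by (intro subst_base) auto
    ultimately have "subst gen_val (c 0) = 0 \<and> subst gen_val (c 1) = 0 \<and> subst gen_val (c 2) = 0
      \<and> subst gen_val (c 3) = 0 \<and> subst gen_val (c 4) = 0 \<and> subst gen_val (c 5) = 0
      \<and> subst gen_val (c 6) = 0 \<and> subst gen_val (c 7) = 0 \<and> subst gen_val (c 8) = 0
      \<and> subst gen_val (c 9) = 0 \<and> subst gen_val (c 10) = 0 \<and> subst gen_val (c 11) = 0"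
      by simp
    then have "subst gen_val (c k) = 0" if "k < 12" for k
      using that by (simp add: eval_nat_numeral less_Suc_eq del: power_Suc) auto
    then have "c k = 0" if "k < 12" for k
      using that i(2) base_inject by blast
    then have "p = i" by (simp add: i(3))
    then show "p \<in> relation_ideal" using i(1) by simp
  qed
qed

section \<open>Generation of the invariants\<close>

lemma act_simps [simp]:
  "act g (p + q) = act g p + act g q"
  "act g (p * q) = act g p * act g q"
  "act g (p - q) = act g p - act g q"
  "act g (- p) = - act g p"
  "act g (p ^ n) = act g p ^ n"
  "act g (Const c) = Const c"
  "act g 0 = 0"
  by (simp_all add: act_def)

lemma permutes_3_cases:
  assumes "\<sigma> permutes {1..3::nat}"
  shows "(\<sigma> 1, \<sigma> 2, \<sigma> 3) \<in> {(1,2,3), (1,3,2), (2,1,3), (2,3,1), (3,1,2), (3,2,1)}"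
proof -
  have cases: "(x, y, z) \<in> {(1,2,3), (1,3,2), (2,1,3), (2,3,1), (3,1,2), (3,2,1)}"
    if "x \<in> {1..3}" "y \<in> {1..3}" "z \<in> {1..3}" "x \<noteq> y" "x \<noteq> z" "y \<noteq> z" for x y z :: nat
  proof -
    have "x = 1 \<or> x = 2 \<or> x = 3" "y = 1 \<or> y = 2 \<or> y = 3" "z = 1 \<or> z = 2 \<or> z = 3"
      using that(1-3) by (simp_all only: atLeastAtMost_iff) arith+
    with that(4-6) show ?thesis by (elim disjE) simp_all
  qed
  have "\<sigma> i \<in> {1..3}" if "i \<in> {1..3}" for i
    using permutes_in_image[OF assms] that by blast
  then have "\<sigma> 1 \<in> {1..3}" "\<sigma> 2 \<in> {1..3}" "\<sigma> 3 \<in> {1..3}" by force+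
  then show ?thesis
    by (rule cases) (simp_all add: inj_eq[OF permutes_inj[OF assms]])
qed

lemma a_3: "a 3 = - a 1 - a 2" and b_3: "b 3 = - b 1 - b 2"
  by (simp_all add: a_def b_def)

lemma act_a:
  assumes "\<sigma> permutes {1..3}"
  shows "act (\<sigma>, \<epsilon>) (a 1) = of_int \<epsilon> * a (\<sigma> 1)" "act (\<sigma>, \<epsilon>) (a 2) = of_int \<epsilon> * a (\<sigma> 2)"
    "act (\<sigma>, \<epsilon>) (a 3) = of_int \<epsilon> * a (\<sigma> 3)"
    "act (\<sigma>, \<epsilon>) (b 1) = of_int \<epsilon> * b (\<sigma> 1)" "act (\<sigma>, \<epsilon>) (b 2) = of_int \<epsilon> * b (\<sigma> 2)"
    "act (\<sigma>, \<epsilon>) (b 3) = of_int \<epsilon> * b (\<sigma> 3)"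
proof -
  have a: "a 1 = Var A1" "a 2 = Var A2" and b: "b 1 = Var B1" "b 2 = Var B2"
    by (simp_all add: a_def b_def)
  show 1: "act (\<sigma>, \<epsilon>) (a 1) = of_int \<epsilon> * a (\<sigma> 1)" "act (\<sigma>, \<epsilon>) (a 2) = of_int \<epsilon> * a (\<sigma> 2)"
    "act (\<sigma>, \<epsilon>) (b 1) = of_int \<epsilon> * b (\<sigma> 1)" "act (\<sigma>, \<epsilon>) (b 2) = of_int \<epsilon> * b (\<sigma> 2)"
    by (simp_all only: a b act_def subst_simps act_var.simps)
  have "a (\<sigma> 3) = - a (\<sigma> 1) - a (\<sigma> 2)" "b (\<sigma> 3) = - b (\<sigma> 1) - b (\<sigma> 2)"
    using permutes_3_cases[OF assms] by (auto simp: a_3 b_3)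
  moreover have "act (\<sigma>, \<epsilon>) (a 3) = of_int \<epsilon> * (- a (\<sigma> 1) - a (\<sigma> 2))"
    "act (\<sigma>, \<epsilon>) (b 3) = of_int \<epsilon> * (- b (\<sigma> 1) - b (\<sigma> 2))"
    by (simp_all add: a_3 b_3 1 algebra_simps del: One_nat_def)
  ultimately show "act (\<sigma>, \<epsilon>) (a 3) = of_int \<epsilon> * a (\<sigma> 3)" "act (\<sigma>, \<epsilon>) (b 3) = of_int \<epsilon> * b (\<sigma> 3)"
    by simp_all
qed

text \<open>A permutation only reorders the summands or factors, and the sign survives exactly in
  odd degree: \<open>S1\<close>, \<open>S2\<close>, \<open>H\<close> have degree 2, the others
  degree 3.\<close>

lemma act_basic:
  assumes "\<sigma> permutes {1..3}" "\<epsilon> \<in> {- 1, 1}"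
  shows "act (\<sigma>, \<epsilon>) S1 = S1" "act (\<sigma>, \<epsilon>) S2 = S2" "act (\<sigma>, \<epsilon>) H = H"
    "act (\<sigma>, \<epsilon>) T1 = of_int \<epsilon> * T1" "act (\<sigma>, \<epsilon>) T2 = of_int \<epsilon> * T2"
    "act (\<sigma>, \<epsilon>) U1 = of_int \<epsilon> * U1" "act (\<sigma>, \<epsilon>) U2 = of_int \<epsilon> * U2"
proof -
  have sq: "of_int \<epsilon> * (of_int \<epsilon> * p) = (p :: var cpoly)" "(of_int \<epsilon>)^2 = (1 :: var cpoly)" for p
    using assms(2) by (auto simp: power2_eq_square)
  show "act (\<sigma>, \<epsilon>) S1 = S1" "act (\<sigma>, \<epsilon>) S2 = S2" "act (\<sigma>, \<epsilon>) H = H"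
    "act (\<sigma>, \<epsilon>) T1 = of_int \<epsilon> * T1" "act (\<sigma>, \<epsilon>) T2 = of_int \<epsilon> * T2"
    "act (\<sigma>, \<epsilon>) U1 = of_int \<epsilon> * U1" "act (\<sigma>, \<epsilon>) U2 = of_int \<epsilon> * U2"
    unfolding S1_def S2_def H_def T1_def T2_def U1_def U2_def act_simps act_a[OF assms(1)] power_mult_distrib sq
    using permutes_3_cases[OF assms(1)]
    by (elim insertE emptyE Pair_inject; simp only: mult_ac add_ac distrib_left sq mult_1_left)+
qed

abbreviation "invariant_generators \<equiv> {S1, T1', S2, T2', Z, H, U11, U12, U21, U22}"

lemma generated_invariant:
  assumes "Q \<in> generated_algebra invariant_generators" "\<sigma> permutes {1..3}" "\<epsilon> \<in> {- 1, 1}"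
  shows "act (\<sigma>, \<epsilon>) Q = Q"
  using assms(1)
proof induction
  case (gen x)
  have "of_int \<epsilon> * of_int \<epsilon> = (1 :: var cpoly)" using assms(3) by auto
  then have "(of_int \<epsilon> * p) * (of_int \<epsilon> * q) = p * q" for p q :: "var cpoly"
    by (metis mult.assoc mult.left_commute mult.left_neutral)
  then show ?case
    using gen by (auto simp: generator_defs act_basic[OF assms(2,3)] power2_eq_square)
qed simp_all

lemma carrier_G2: "(\<sigma>, \<epsilon>) \<in> carrier G2 \<longleftrightarrow> \<sigma> permutes {1..3} \<and> \<epsilon> \<in> {- 1, 1}"
  by (auto simp: G2_def sym_group_def sign_img_def)

lemma generated_subset_invariants: "generated_algebra invariant_generators \<subseteq> invariants"
  by (auto simp: invariants_def carrier_G2 intro!: generated_invariant)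

text \<open>The 3-cycle sending 1 to 2, 2 to 3 and 3 to 1. Together with \<open>swap\<close> it
  generates the symmetric group.\<close>

definition rot :: "nat \<Rightarrow> nat" where "rot = transpose 1 2 \<circ> transpose 2 3"
definition swap :: "nat \<Rightarrow> nat" where "swap = transpose 2 3"

lemma rot_permutes: "rot permutes {1..3}"
  unfolding rot_def by (intro permutes_compose permutes_swap_id) auto

lemma swap_permutes: "swap permutes {1..3}"
  unfolding swap_def by (intro permutes_swap_id) auto

lemma act_coordinates:
  "act (rot, 1) pU = Const (omega^2) * pU" "act (rot, 1) pV = Const omega * pV"
  "act (rot, 1) pX = Const (omega^2) * pX" "act (rot, 1) pY = Const omega * pY"
  "act (swap, 1) pU = pV" "act (swap, 1) pV = pU"
  "act (swap, 1) pX = pY" "act (swap, 1) pY = pX"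
proof -
  have r: "rot 1 = 2" "rot 2 = 3" "rot 3 = 1"
    by (simp_all add: rot_def transpose_def del: One_nat_def)
  have s: "swap 1 = 1" "swap 2 = 3" "swap 3 = 2"
    by (simp_all add: swap_def transpose_def)
  note ar = act_a[OF rot_permutes, unfolded r] and as = act_a[OF swap_permutes, unfolded s]
  show "act (rot, 1) pU = Const (omega^2) * pU" "act (rot, 1) pV = Const omega * pV"
    "act (rot, 1) pX = Const (omega^2) * pX" "act (rot, 1) pY = Const omega * pY"
    by (rule eval_point_inject, simp add: pU_def pV_def pX_def pY_def ar eval_a del: One_nat_def,
        use omega_square in algebra)+
  show "act (swap, 1) pU = pV" "act (swap, 1) pV = pU"
    "act (swap, 1) pX = pY" "act (swap, 1) pY = pX"
    by (simp_all add: pU_def pV_def pX_def pY_def as algebra_simps del: One_nat_def)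
qed

section \<open>Invariants of \<open>A2\<close> by averaging monomials\<close>

definition mon :: "nat \<Rightarrow> nat \<Rightarrow> nat \<Rightarrow> nat \<Rightarrow> var cpoly"
  where "mon i j k l = pU^i * pV^j * pX^k * pY^l"

lemma act_swap_mon: "act (swap, 1) (mon i j k l) = mon j i l k"
  by (simp add: mon_def act_coordinates mult_ac)

lemma act_rot_mon: "act (rot, 1) (mon i j k l) = Const (omega ^ (2 * i + j + 2 * k + l)) * mon i j k l"
  by (rule eval_point_inject)
    (simp add: mon_def act_coordinates power_mult_distrib power_add mult_2 power2_eq_square)

abbreviation "A2_invariant_algebra \<equiv> generated_algebra {S1, T1, S2, T2, H, U1, U2}"

text \<open>A monomial fixed by the swap is counted twice.\<close>

definition mon_sym :: "nat \<Rightarrow> nat \<Rightarrow> nat \<Rightarrow> nat \<Rightarrow> var cpoly"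
  where "mon_sym i j k l = mon i j k l + mon j i l k"

lemma mon_sym_commute: "mon_sym j i l k = mon_sym i j k l"
  by (simp add: mon_sym_def)

lemma A2_generators:
  "S1 \<in> A2_invariant_algebra" "S2 \<in> A2_invariant_algebra" "T1 \<in> A2_invariant_algebra"
  "T2 \<in> A2_invariant_algebra" "H \<in> A2_invariant_algebra" "U1 \<in> A2_invariant_algebra"
  "U2 \<in> A2_invariant_algebra"
  by (simp_all add: generated_algebra.gen)

text \<open>
  In addition to the factors \<open>uv\<close> and \<open>xy\<close>, the reduction uses
  \<open>u^(i+4) = (u^3 + v^3) u^(i+1) - uv u^i v^2\<close>.
\<close>

lemma mon_sym_reduce:
  "mon_sym (Suc i) (Suc j) k l = 3 * S1 * mon_sym i j k l"
  "mon_sym i j (Suc k) (Suc l) = 3 * S2 * mon_sym i j k l"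
  "mon_sym (i + 4) j k l = - 9 * T1 * mon_sym (i + 1) j k l - 3 * S1 * mon_sym i (j + 2) k l"
  "mon_sym i j (k + 4) l = - 9 * T2 * mon_sym i j (k + 1) l - 3 * S2 * mon_sym i j k (l + 2)"
  by (rule eval_point_inject, simp add: mon_sym_def mon_def field_simps eval_nat_numeral)+

text \<open>Up to the swap these are all the cases without a factor \<open>uv\<close> or
  \<open>xy\<close>, with exponents below 4 and invariant under the 3-cycle.\<close>

lemma mon_sym_small:
  "mon_sym 0 0 0 0 = 2" "mon_sym 3 0 0 0 = - 9 * T1" "mon_sym 0 0 3 0 = - 9 * T2"
  "mon_sym 3 0 3 0 = 81 * T1 * T2 + 27 * H^3 - 81 * S1 * S2 * H"
  "mon_sym 3 0 0 3 = - 27 * H^3 + 81 * S1 * S2 * H"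
  "mon_sym 1 0 2 0 = - 3 * U1" "mon_sym 1 0 0 1 = - 3 * H" "mon_sym 2 0 1 0 = - 3 * U2"
  "mon_sym 2 0 0 2 = 9 * H^2 - 18 * S1 * S2"
  by (rule eval_point_inject, simp add: mon_sym_def mon_def field_simps eval_nat_numeral)+

text \<open>The hypothesis says that the 3-cycle fixes the monomial. The reductions lower the degree
  and keep the weight modulo 3, so the induction ends at the monomials of
  \<open>mon_sym_small\<close>.\<close>

lemma mon_sym_in_algebra:
  "3 dvd 2 * i + j + 2 * k + l \<Longrightarrow> mon_sym i j k l \<in> A2_invariant_algebra"
proof (induction "i + j + k + l" arbitrary: i j k l rule: less_induct)
  case less
  \<comment> \<open>Stated for all exponents of the same total degree, so that it also applies to
    the mirror image when the large exponent belongs to \<open>v\<close> or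
    \<open>y\<close>.\<close>
  have big: "mon_sym i' j' k' l' \<in> A2_invariant_algebra"
    if "i' \<ge> 4 \<or> k' \<ge> 4" "i' + j' + k' + l' = i + j + k + l" "3 dvd 2 * i' + j' + 2 * k' + l'" for i' j' k' l'
    using that(1)
  proof
    assume "i' \<ge> 4"
    then obtain n where n: "i' = n + 4" using le_Suc_ex by (metis add.commute)
    have *: "mon_sym (n + 1) j' k' l' \<in> A2_invariant_algebra" "mon_sym n (j' + 2) k' l' \<in> A2_invariant_algebra"
      by (rule less.hyps; use that n in \<open>simp; presburger?\<close>)+
    then show ?thesis
      unfolding n mon_sym_reduce(3) by (intro generated_algebra_intros A2_generators *)
  next
    assume "k' \<ge> 4"
    then obtain n where n: "k' = n + 4" using le_Suc_ex by (metis add.commute)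
    have *: "mon_sym i' j' (n + 1) l' \<in> A2_invariant_algebra" "mon_sym i' j' n (l' + 2) \<in> A2_invariant_algebra"
      by (rule less.hyps; use that n in \<open>simp; presburger?\<close>)+
    then show ?thesis
      unfolding n mon_sym_reduce(4) by (intro generated_algebra_intros A2_generators *)
  qed
  consider "i > 0" "j > 0" | "k > 0" "l > 0" | "i \<ge> 4 \<or> k \<ge> 4" | "j \<ge> 4 \<or> l \<ge> 4"
    | "i = 0 \<or> j = 0" "k = 0 \<or> l = 0" "i < 4" "j < 4" "k < 4" "l < 4" by linarith
  then show ?case
  proof cases
    case 1
    then obtain m n where mn: "i = Suc m" "j = Suc n" by (metis gr0_implies_Suc)
    have *: "mon_sym m n k l \<in> A2_invariant_algebra"
      by (rule less.hyps; use less.prems mn in \<open>simp; presburger?\<close>)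
    then show ?thesis
      unfolding mn mon_sym_reduce(1) by (intro generated_algebra_intros A2_generators *)
  next
    case 2
    then obtain m n where mn: "k = Suc m" "l = Suc n" by (metis gr0_implies_Suc)
    have *: "mon_sym i j m n \<in> A2_invariant_algebra"
      by (rule less.hyps; use less.prems mn in \<open>simp; presburger?\<close>)
    then show ?thesis
      unfolding mn mon_sym_reduce(2) by (intro generated_algebra_intros A2_generators *)
  next
    case 3
    then show ?thesis using big[of i k j l] less.prems by blast
  next
    case 4
    have "3 dvd 2 * j + i + 2 * l + k" using less.prems by presburger
    then show ?thesis using big[of j l i k] 4 by (simp add: add_ac mon_sym_commute)
  next
    case 5
    have "(i, j, k, l) \<in> {(0,0,0,0), (3,0,0,0), (0,0,3,0), (3,0,3,0), (3,0,0,3), (1,0,2,0), (1,0,0,1),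
        (2,0,1,0), (2,0,0,2)} \<or> (j, i, l, k) \<in> {(0,0,0,0), (3,0,0,0), (0,0,3,0), (3,0,3,0), (3,0,0,3),
        (1,0,2,0), (1,0,0,1), (2,0,1,0), (2,0,0,2)}"
    proof -
      have less_4: "n = 0 \<or> n = 1 \<or> n = 2 \<or> n = 3" if "n < 4" for n :: nat using that by arith
      \<comment> \<open>\<open>eq\<close> treats two remaining coordinates on which the 3-cycle acts
        by the same factor, \<open>opp\<close> two with inverse factors.\<close>
      have eq: "(m, n) \<in> {(0,0), (3,0), (0,3), (3,3), (1,2), (2,1)}" if "m < 4" "n < 4" "3 dvd m + n" for m n :: nat
        using less_4[OF that(1)] less_4[OF that(2)] that(3)
        by (elim disjE) (simp_all add: dvd_eq_mod_eq_0)
      have opp: "(m, n) \<in> {(0,0), (3,0), (0,3), (3,3), (1,1), (2,2)}" if "m < 4" "n < 4" "3 dvd 2 * m + n" for m n :: nat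
        using less_4[OF that(1)] less_4[OF that(2)] that(3)
        by (elim disjE) (simp_all add: dvd_eq_mod_eq_0)
      consider "i = 0" "k = 0" | "i = 0" "l = 0" | "j = 0" "k = 0" | "j = 0" "l = 0"
        using 5 by blast
      then show ?thesis
      proof cases
        case 1
        then have "3 dvd j + l" using less.prems by simp
        from eq[OF 5(4,6) this] 1 show ?thesis by (elim insertE emptyE Pair_inject) simp_all
      next
        case 2
        then have "3 dvd 2 * k + j" using less.prems by (simp add: add.commute)
        from opp[OF 5(5,4) this] 2 show ?thesis by (elim insertE emptyE Pair_inject) simp_all
      next
        case 3
        then have "3 dvd 2 * i + l" using less.prems by simp
        from opp[OF 5(3,6) this] 3 show ?thesis by (elim insertE emptyE Pair_inject) simp_all
      next
        case 4
        then have "3 dvd i + k" using less.prems by presburger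
        from eq[OF 5(3,5) this] 4 show ?thesis by (elim insertE emptyE Pair_inject) simp_all
      qed
    qed
    moreover have *: "mon_sym i' j' k' l' \<in> A2_invariant_algebra"
      if "(i', j', k', l') \<in> {(0,0,0,0), (3,0,0,0), (0,0,3,0), (3,0,3,0), (3,0,0,3), (1,0,2,0), (1,0,0,1),
        (2,0,1,0), (2,0,0,2)}" for i' j' k' l'
      using that
      by (elim insertE emptyE Pair_inject; hypsubst)
        (unfold mon_sym_small, (intro generated_algebra_intros A2_generators)+)
    ultimately show ?thesis by (metis mon_sym_commute)
  qed
qed

text \<open>The sum over the six elements of \<open>A2\<close>. The rotations contribute the factor
  \<open>c\<close>, a sum of three powers of a cube root of unity, which vanishes unless the 3-cycle
  fixes the monomial.\<close>

lemma sum_orbit_mon: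
  "act (swap, 1) (p + act (rot, 1) p + act (rot, 1) (act (rot, 1) p))
    + (p + act (rot, 1) p + act (rot, 1) (act (rot, 1) p)) \<in> A2_invariant_algebra"
  if "p = mon i j k l"
proof -
  define n where "n = 2 * i + j + 2 * k + l"
  define c where "c = 1 + omega ^ n + omega ^ n * omega ^ n"
  have "p + act (rot, 1) p + act (rot, 1) (act (rot, 1) p) = Const c * p"
    by (simp add: that act_rot_mon c_def n_def Const_add Const_mult algebra_simps)
  then have eq: "act (swap, 1) (p + act (rot, 1) p + act (rot, 1) (act (rot, 1) p))
    + (p + act (rot, 1) p + act (rot, 1) (act (rot, 1) p)) = Const c * mon_sym i j k l"
    by (simp add: that act_swap_mon mon_sym_def algebra_simps)
  show ?thesis
  proof (cases "3 dvd n")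
    case True
    then show ?thesis
      unfolding eq using mon_sym_in_algebra[of i j k l]
      by (auto simp: n_def intro: generated_algebra_intros)
  next
    case False
    then have "n = 3 * (n div 3) + 1 \<or> n = 3 * (n div 3) + 2" by presburger
    then have "omega ^ n = omega ^ (3 * (n div 3) + 1) \<or> omega ^ n = omega ^ (3 * (n div 3) + 2)"
      by metis
    then have "omega ^ n = omega \<or> omega ^ n = omega ^ 2"
      by (auto simp: power_add power_mult omega_cube power2_eq_square)
    then have "c = 0"
    proof
      assume *: "omega ^ n = omega"
      show ?thesis unfolding c_def * using omega_square by algebra
    next
      assume *: "omega ^ n = omega ^ 2"
      show ?thesis unfolding c_def * using omega_square by algebra
    qed
    then show ?thesis unfolding eq by (simp add: generated_algebra_0)
  qed
qed

lemma var_cpoly_cases: obtains q where "p = subst (case_var pU pV pX pY) q"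
proof
  \<comment> \<open>The inverse change of coordinates, with the four variables now standing for
    \<open>u\<close>, \<open>v\<close>, \<open>x\<close>, \<open>y\<close>.\<close>
  define \<phi> where "\<phi> v = (case v of A1 \<Rightarrow> Var A1 + Var A2
    | A2 \<Rightarrow> Const (omega^2) * Var A1 + Const omega * Var A2 | B1 \<Rightarrow> Var B1 + Var B2
    | B2 \<Rightarrow> Const (omega^2) * Var B1 + Const omega * Var B2)" for v
  have "eval_at (point u v x y) (subst (case_var pU pV pX pY) (\<phi> i)) = point u v x y i" for u v x y i
    by (cases i) (simp_all add: \<phi>_def point_def)
  then show "p = subst (case_var pU pV pX pY) (subst \<phi> p)"
    by (intro eval_point_inject) (simp add: eval_at_subst)
qed

text \<open>\<open>?N\<close> is linear, and S is spanned by the monomials in the diagonal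
  coordinates.\<close>

lemma sum_orbit:
  "act (swap, 1) (p + act (rot, 1) p + act (rot, 1) (act (rot, 1) p))
    + (p + act (rot, 1) p + act (rot, 1) (act (rot, 1) p)) \<in> A2_invariant_algebra" (is "?N p \<in> _")
proof -
  obtain q where "p = subst (case_var pU pV pX pY) q" by (rule var_cpoly_cases)
  moreover have "?N (subst (case_var pU pV pX pY) q) \<in> A2_invariant_algebra"
  proof (induction q rule: poly_mapping_add_induct)
    case (single m c)
    let ?m = "Poly_Mapping.lookup m"
    have UNIV_var: "(UNIV :: var set) = {A1, A2, B1, B2}" using var.exhaust by auto
    have "finite (UNIV :: var set)" by (simp add: UNIV_var)
    then have "monom_val (case_var pU pV pX pY) m = (\<Prod>v\<in>UNIV. case_var pU pV pX pY v ^ ?m v)"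
      by (rule monom_val_superset) (rule subset_UNIV)
    then have "monom_val (case_var pU pV pX pY) m = mon (?m A1) (?m A2) (?m B1) (?m B2)"
      by (simp add: UNIV_var mon_def mult.assoc)
    then have eq: "subst (case_var pU pV pX pY) (Poly_Mapping.single m c)
        = Const c * mon (?m A1) (?m A2) (?m B1) (?m B2)"
      by (simp add: subst_eq_ev)
    have N: "?N (Const c * r) = Const c * ?N r" for r
      by (simp add: algebra_simps)
    show ?case
      unfolding eq N by (rule generated_algebra.mult[OF generated_algebra.const sum_orbit_mon[OF refl]])
  next
    case (add q r)
    have "?N (r + s) = ?N r + ?N s" for r s by (simp add: algebra_simps)
    then show ?case
      unfolding subst_simps by (simp only:) (intro generated_algebra.add add.IH)
  qed
  ultimately show ?thesis by simp
qed

lemma scale_inverse: "c \<noteq> 0 \<Longrightarrow> Const (1 / c) * (Const c * p) = p"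
  by (simp flip: mult.assoc Const_mult)

text \<open>On an invariant the orbit sum is six times the element, and 6 is invertible.\<close>

lemma invariants_subset_A2: "invariants \<subseteq> A2_invariant_algebra"
proof
  fix Q assume "Q \<in> invariants"
  then have "act (rot, 1) Q = Q" "act (swap, 1) Q = Q"
    using rot_permutes swap_permutes by (auto simp: invariants_def carrier_G2)
  then have "Q + Q + Q + (Q + Q + Q) \<in> A2_invariant_algebra"
    using sum_orbit[of Q] by (simp only: act_simps)
  moreover have "Q + Q + Q + (Q + Q + Q) = Const 6 * Q"
    by (rule eval_at_inject) simp
  ultimately show "Q \<in> A2_invariant_algebra"
    using scale_inverse[of 6 Q] by (metis generated_algebra.const generated_algebra.mult zero_neq_numeral)
qed

section \<open>Parity under the sign change\<close>

abbreviation "even_algebra \<equiv> generated_algebra invariant_generators"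

lemma invariant_generators_in_algebra:
  "S1 \<in> even_algebra" "T1 * T1 \<in> even_algebra" "S2 \<in> even_algebra" "T2 * T2 \<in> even_algebra"
  "T1 * T2 \<in> even_algebra" "H \<in> even_algebra" "T1 * U1 \<in> even_algebra" "T1 * U2 \<in> even_algebra"
  "T2 * U1 \<in> even_algebra" "T2 * U2 \<in> even_algebra"
  by (rule generated_algebra.gen, simp add: generator_defs power2_eq_square)+

lemma odd_products:
  assumes "d \<in> {T1, T2, U1, U2}" "e \<in> {T1, T2, U1, U2}"
  shows "d * e \<in> even_algebra"
proof -
  note g = generated_algebra_intros invariant_generators_in_algebra
  have "U1 * U1 \<in> even_algebra" "U2 * U2 \<in> even_algebra" "U1 * U2 \<in> even_algebra"
    using basic_relations(3-5) unfolding power2_eq_square[of U1] power2_eq_square[of U2]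
    by (simp_all only:) (intro g)+
  then show ?thesis
    using assms invariant_generators_in_algebra by (auto simp: mult.commute)
qed

text \<open>The module over \<open>even_algebra\<close> generated by the four basic invariants of
  odd degree. The sign change acts on it as multiplication by -1.\<close>

inductive_set odd_part :: "var cpoly set"
  where
    zero: "0 \<in> odd_part"
  | mult: "p \<in> even_algebra \<Longrightarrow> d \<in> {T1, T2, U1, U2} \<Longrightarrow> p * d \<in> odd_part"
  | add: "p \<in> odd_part \<Longrightarrow> q \<in> odd_part \<Longrightarrow> p + q \<in> odd_part"

lemma even_mult_odd_part: "p \<in> odd_part \<Longrightarrow> q \<in> even_algebra \<Longrightarrow> q * p \<in> odd_part"
proof (induction rule: odd_part.induct)
  case (mult p d)
  then show ?case using odd_part.mult[of "q * p" d] by (simp add: mult.assoc generated_algebra.mult)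
qed (auto simp: distrib_left intro: odd_part.intros)

lemma odd_part_mult:
  assumes "p \<in> odd_part" "q \<in> odd_part"
  shows "p * q \<in> even_algebra"
  using assms
proof (induction arbitrary: q rule: odd_part.induct)
  case (mult p d)
  from mult(3) have "d * q \<in> even_algebra"
  proof induction
    case (mult r e)
    then have "r * (d * e) \<in> even_algebra"
      using odd_products \<open>d \<in> {T1, T2, U1, U2}\<close> by (blast intro: generated_algebra.mult)
    then show ?case by (simp add: mult_ac)
  qed (auto simp: distrib_left intro: generated_algebra_intros)
  then show ?case using mult(1) by (simp add: mult.assoc generated_algebra.mult)
qed (auto simp: distrib_right intro: generated_algebra_intros)

text \<open>Sums of this form are closed under products because a product of two odd elements is
  even.\<close>

lemma even_odd_decomposition:
  assumes "p \<in> A2_invariant_algebra"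
  shows "\<exists>e\<in>even_algebra. \<exists>d\<in>odd_part. p = e + d"
  using assms
proof induction
  case (const c)
  show ?case
    by (rule bexI[of _ "Const c"], rule bexI[of _ 0]) (auto intro: generated_algebra.const odd_part.zero)
next
  case (gen x)
  have "d \<in> odd_part" if "d \<in> {T1, T2, U1, U2}" for d
    using odd_part.mult[OF generated_algebra_1 that] by simp
  then have "x \<in> odd_part \<or> x \<in> even_algebra"
    using gen invariant_generators_in_algebra by auto
  then show ?case
  proof
    assume "x \<in> odd_part"
    then show ?thesis by (intro bexI[of _ 0] bexI[of _ x] generated_algebra_0) simp
  next
    assume "x \<in> even_algebra"
    then show ?thesis by (intro bexI[of _ x] bexI[of _ 0] odd_part.zero) simp
  qed
next
  case (add p q)
  then obtain e d e' d' where "e \<in> even_algebra" "d \<in> odd_part" "p = e + d"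
    "e' \<in> even_algebra" "d' \<in> odd_part" "q = e' + d'" by blast
  moreover from this have "p + q = (e + e') + (d + d')" by (simp add: add_ac)
  ultimately show ?case by (blast intro: generated_algebra.add odd_part.add)
next
  case (mult p q)
  then obtain e d e' d' where "e \<in> even_algebra" "d \<in> odd_part" "p = e + d"
    "e' \<in> even_algebra" "d' \<in> odd_part" "q = e' + d'" by blast
  moreover from this have "p * q = (e * e' + d * d') + (e * d' + e' * d)" by (simp add: algebra_simps)
  moreover from calculation have "e * e' + d * d' \<in> even_algebra" "e * d' + e' * d \<in> odd_part"
    by (simp_all add: generated_algebra.add generated_algebra.mult odd_part.add odd_part_mult even_mult_odd_part)
  ultimately show ?case by blast
qed

lemma act_odd_part: "d \<in> odd_part \<Longrightarrow> act (id, - 1) d = - d"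
proof (induction rule: odd_part.induct)
  case (mult p d)
  have "act (id, - 1) d = - d"
    using mult(2) act_basic[OF permutes_id, of "- 1"] by auto
  then show ?case
    using generated_invariant[OF mult(1) permutes_id, of "- 1"]
    by (simp only: act_simps mult_minus_right insert_iff simp_thms)
qed simp_all

text \<open>The sign change fixes the even part and negates the odd part, so the odd part of an
  invariant equals its own negative and is zero.\<close>

lemma invariants_eq_generated: "invariants = even_algebra"
proof
  show "invariants \<subseteq> even_algebra"
  proof
    fix Q assume Q: "Q \<in> invariants"
    then obtain e d where ed: "e \<in> even_algebra" "d \<in> odd_part" "Q = e + d"
      using invariants_subset_A2 even_odd_decomposition by blast
    have "act (id, - 1) Q = Q"
      using Q by (simp add: invariants_def carrier_G2)
    then have "- d = d"
      using generated_invariant[OF ed(1) permutes_id, of "- 1"] act_odd_part[OF ed(2)] ed(3) by simp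
    have "eval_at f d = 0" for f
      using arg_cong[OF \<open>- d = d\<close>, of "eval_at f"] by (simp add: neg_eq_iff_add_eq_0 flip: mult_2)
    then have "d = 0" by (rule eval_at_zero_imp_zero)
    then show "Q \<in> even_algebra" using ed by simp
  qed
qed (rule generated_subset_invariants)

section \<open>Uniqueness and existence of the normal form\<close>

lemma normal_form_unique:
  assumes "{P0, P1, P2, P3, Q0, Q1, Q2, Q3, Q11, Q21, Q12, Q22} \<subseteq> R'"
    and "{P0', P1', P2', P3', Q0', Q1', Q2', Q3', Q11', Q21', Q12', Q22'} \<subseteq> R'"
    and "P0 + P1 * H + P2 * H^2 + P3 * H^3 + Q0 * Z + Q1 * Z * H + Q2 * Z * H^2 + Q3 * Z * H^3
        + Q11 * U11 + Q21 * U21 + Q12 * U12 + Q22 * U22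
      = P0' + P1' * H + P2' * H^2 + P3' * H^3 + Q0' * Z + Q1' * Z * H + Q2' * Z * H^2 + Q3' * Z * H^3
        + Q11' * U11 + Q21' * U21 + Q12' * U12 + Q22' * U22"
  shows "(P0, P1, P2, P3, Q0, Q1, Q2, Q3, Q11, Q21, Q12, Q22)
    = (P0', P1', P2', P3', Q0', Q1', Q2', Q3', Q11', Q21', Q12', Q22')"
proof -
  have "p - q \<in> R'" if "p \<in> R'" "q \<in> R'" for p q
    using that unfolding R'_def by (rule generated_algebra_diff)
  then have R: "{P0 - P0', P1 - P1', P2 - P2', P3 - P3', Q0 - Q0', Q1 - Q1', Q2 - Q2', Q3 - Q3',
      Q11 - Q11', Q21 - Q21', Q12 - Q12', Q22 - Q22'} \<subseteq> R'"
    using assms(1,2) by simp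
  have "(P0 - P0') + (P1 - P1') * H + (P2 - P2') * H^2 + (P3 - P3') * H^3 + (Q0 - Q0') * Z
      + (Q1 - Q1') * Z * H + (Q2 - Q2') * Z * H^2 + (Q3 - Q3') * Z * H^3
      + (Q11 - Q11') * U11 + (Q21 - Q21') * U21 + (Q12 - Q12') * U12 + (Q22 - Q22') * U22
    = (P0 + P1 * H + P2 * H^2 + P3 * H^3 + Q0 * Z + Q1 * Z * H + Q2 * Z * H^2 + Q3 * Z * H^3
        + Q11 * U11 + Q21 * U21 + Q12 * U12 + Q22 * U22)
      - (P0' + P1' * H + P2' * H^2 + P3' * H^3 + Q0' * Z + Q1' * Z * H + Q2' * Z * H^2 + Q3' * Z * H^3
        + Q11' * U11 + Q21' * U21 + Q12' * U12 + Q22' * U22)"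
    by (simp only: left_diff_distrib) (simp only: diff_conv_add_uminus minus_add_distrib add_ac)
  also have "\<dots> = 0" using assms(3) by simp
  finally show ?thesis using normal_form_zero[OF R] by simp
qed

lemma range_gen_val: "range (subst gen_val) = even_algebra"
proof -
  have "(UNIV :: gen set) = {G_S1, G_T1', G_S2, G_T2', G_Z, G_H, G_U11, G_U12, G_U21, G_U22}" (is "_ = ?G")
    using gen.exhaust by blast
  moreover have "gen_val ` ?G = invariant_generators" by simp
  ultimately have "range gen_val = invariant_generators" by simp
  then show ?thesis by (simp only: range_subst)
qed

text \<open>A preimage of \<open>Q\<close> in the free algebra is brought to normal form modulo the
  relations; evaluation removes the ideal part.\<close>

lemma normal_form_exists:
  assumes "Q \<in> invariants"
  obtains P0 P1 P2 P3 Q0 Q1 Q2 Q3 Q11 Q21 Q12 Q22 where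
    "{P0, P1, P2, P3, Q0, Q1, Q2, Q3, Q11, Q21, Q12, Q22} \<subseteq> R'"
    "Q = P0 + P1 * H + P2 * H^2 + P3 * H^3 + Q0 * Z + Q1 * Z * H + Q2 * Z * H^2 + Q3 * Z * H^3
      + Q11 * U11 + Q21 * U21 + Q12 * U12 + Q22 * U22"
proof -
  obtain p where p: "Q = subst gen_val p"
    using assms unfolding invariants_eq_generated range_gen_val[symmetric] by blast
  obtain i c where i: "i \<in> relation_ideal" "range c \<subseteq> base" "p = i + (\<Sum>k<12. c k * nf_basis ! k)"
    using normal_form_modulo_relations by blast
  have "Q = subst gen_val (\<Sum>k<12. c k * nf_basis ! k)"
    using relation_ideal_subset_kernel[OF i(1)] by (simp add: p i(3))
  moreover have "subst gen_val (c k) \<in> R'" for k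
    using i(2) by (intro subst_base) auto
  ultimately show ?thesis
    by (intro that[OF _ trans[OF _ subst_normal_form[of c]]]) auto
qed

theorem mainTheorem4:
  shows "invariants = generated_algebra {S1, T1', S2, T2', Z, H, U11, U12, U21, U22}
    \<and> (\<forall>Q\<in>invariants. \<exists>!(P0, P1, P2, P3, Q0, Q1, Q2, Q3, Q11, Q21, Q12, Q22).
          {P0, P1, P2, P3, Q0, Q1, Q2, Q3, Q11, Q21, Q12, Q22} \<subseteq> R' \<and>
          Q = P0 + P1 * H + P2 * H^2 + P3 * H^3
            + Q0 * Z + Q1 * Z * H + Q2 * Z * H^2 + Q3 * Z * H^3
            + Q11 * U11 + Q21 * U21 + Q12 * U12 + Q22 * U22)
    \<and> presented_by invariants gen_val relators"
proof (intro conjI ballI)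
  show "invariants = generated_algebra {S1, T1', S2, T2', Z, H, U11, U12, U21, U22}"
    by (rule invariants_eq_generated)
  show "presented_by invariants gen_val relators"
    unfolding presented_by_def
    by (simp only: range_gen_val invariants_eq_generated kernel_gen_val simp_thms)
  fix Q assume "Q \<in> invariants"
  then obtain P0 P1 P2 P3 Q0 Q1 Q2 Q3 Q11 Q21 Q12 Q22 where P:
    "{P0, P1, P2, P3, Q0, Q1, Q2, Q3, Q11, Q21, Q12, Q22} \<subseteq> R'"
    "Q = P0 + P1 * H + P2 * H^2 + P3 * H^3 + Q0 * Z + Q1 * Z * H + Q2 * Z * H^2 + Q3 * Z * H^3
      + Q11 * U11 + Q21 * U21 + Q12 * U12 + Q22 * U22"
    by (rule normal_form_exists)
  show "\<exists>!(P0, P1, P2, P3, Q0, Q1, Q2, Q3, Q11, Q21, Q12, Q22).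
          {P0, P1, P2, P3, Q0, Q1, Q2, Q3, Q11, Q21, Q12, Q22} \<subseteq> R' \<and>
          Q = P0 + P1 * H + P2 * H^2 + P3 * H^3
            + Q0 * Z + Q1 * Z * H + Q2 * Z * H^2 + Q3 * Z * H^3
            + Q11 * U11 + Q21 * U21 + Q12 * U12 + Q22 * U22"
  proof (rule ex1I[of _ "(P0, P1, P2, P3, Q0, Q1, Q2, Q3, Q11, Q21, Q12, Q22)"],
      unfold split_paired_all prod.case, goal_cases)
    case 1
    show ?case using P by (rule conjI)
  next
    case 2
    show ?case
      by (rule normal_form_unique[OF conjunct1[OF 2] P(1) trans[OF sym[OF conjunct2[OF 2]] P(2)]])
  qed
qed

end
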